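(* Let $A$ be a unital $C^*$-algebra, let $H$ be a uniformly bounded group of invertible elements of $A$, and let $r,s\in A$ be positive invertible elements. Let $\gamma_t=\gamma_{r^2,s^2}(t)$, $t\in[0,1]$, be the geodesic connecting $r^2$ and $s^2$, and let $H_t=\gamma_t^{-1/2}H\gamma_t^{1/2}$ be the corresponding one-parameter family of groups between $H_0=r^{-1}Hr$ and $H_1=s^{-1}Hs$. Then, for all $t\in[0,1]$, $$|H_t|\leq |r^{-1}Hr|^{1-t}\,|s^{-1}Hs|^{t}.$$ If $H$ is also unitarizable, then for all $t\in[0,1]$ $$\operatorname{sim}(H_t)\leq \operatorname{sim}(r^{-1}Hr)^{1-t}\,\operatorname{sim}(s^{-1}Hs)^{t}.$$ In particular, if $s$ is a positive unitarizer of $H$ such that $\operatorname{dist}(\mathrm{Id},P^H)=d(\mathrm{Id},s^2)$, then the one-parameter family of groups $H_t=s^{-t}Hs^t$ satisfies, for all $t\in[0,1]$, $$|H_t|\leq |H|^{1-t}\quad\text{and}\quad \operatorname{sim}(H_t)=\operatorname{sim}(H)^{1-t}.$$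
   Context: $P$ is the set of positive invertible elements of $A$, with unit $\mathrm{Id}$ and metric $d(a,b)=\|\log(a^{-1/2}ba^{-1/2})\|$. For $a,b\in P$ the geodesic is $\gamma_{a,b}(t)=a^{1/2}(a^{-1/2}ba^{-1/2})^ta^{1/2}$. For a group $H$ of invertible elements of $A$: $P^H=\{a\in P: hah^*=a\ \forall h\in H\}$ and $\operatorname{dist}(\mathrm{Id},P^H)=\inf_{a\in P^H}d(\mathrm{Id},a)$; $|H|=\sup_{h\in H}\|h\|$, and $H$ is uniformly bounded if $|H|<\infty$; a unitarizer of $H$ is an invertible $s\in A$ such that $s^{-1}Hs$ consists of unitaries, and $H$ is unitarizable if a unitarizer exists; $\operatorname{sim}(H)=\inf\{\|s\|\|s^{-1}\|: s \text{ is a unitarizer of } H\}$. *)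

theory Defs
  imports "HOL-Analysis.Analysis" "HOL-Computational_Algebra.Polynomial"
begin

text \<open>
  Unital C*-algebras as a type class. The real structure (norm, completeness, exponents of the
  norm) comes from the library classes; the complex scalar multiplication is required to extend
  the real one. As part of \<^class>\<open>real_normed_algebra_1\<close> we have \<open>norm 1 = 1\<close>, which for a
  C*-algebra only excludes the zero algebra.
\<close>

class unital_cstar_algebra = real_normed_algebra_1 + banach +
  fixes scaleC :: "complex \<Rightarrow> 'a \<Rightarrow> 'a" (infixr "*\<^sub>C" 75)
    and star :: "'a \<Rightarrow> 'a"
  assumes scaleC_of_real: "complex_of_real x *\<^sub>C a = x *\<^sub>R a"
    and scaleC_add_right: "z *\<^sub>C (a + b) = z *\<^sub>C a + z *\<^sub>C b"
    and scaleC_add_left: "(z + w) *\<^sub>C a = z *\<^sub>C a + w *\<^sub>C a"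
    and scaleC_scaleC: "z *\<^sub>C w *\<^sub>C a = (z * w) *\<^sub>C a"
    and mult_scaleC_left: "(z *\<^sub>C a) * b = z *\<^sub>C (a * b)"
    and mult_scaleC_right: "a * (z *\<^sub>C b) = z *\<^sub>C (a * b)"
    and norm_scaleC: "norm (z *\<^sub>C a) = cmod z * norm a"
    and star_add: "star (a + b) = star a + star b"
    and star_scaleC: "star (z *\<^sub>C a) = cnj z *\<^sub>C star a"
    and star_mult: "star (a * b) = star b * star a"
    and star_star: "star (star a) = a"
    and cstar_identity: "norm (star a * a) = (norm a)\<^sup>2"

instantiation complex :: unital_cstar_algebra
begin

definition scaleC_complex :: "complex \<Rightarrow> complex \<Rightarrow> complex" where
  "scaleC_complex z a = z * a"

definition star_complex :: "complex \<Rightarrow> complex" where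
  "star_complex = cnj"

instance
  by standard
    (auto simp: scaleC_complex_def star_complex_def algebra_simps norm_mult power2_eq_square
      scaleR_conv_of_real)

end

definition is_inverse :: "'a::ring_1 \<Rightarrow> 'a \<Rightarrow> bool" where
  "is_inverse a b \<longleftrightarrow> a * b = 1 \<and> b * a = 1"

definition invertible_elt :: "'a::ring_1 \<Rightarrow> bool" where
  "invertible_elt a \<longleftrightarrow> (\<exists>b. is_inverse a b)"

definition inv_elt :: "'a::ring_1 \<Rightarrow> 'a" where
  "inv_elt a = (THE b. is_inverse a b)"

definition unitary :: "'a::unital_cstar_algebra \<Rightarrow> bool" where
  "unitary u \<longleftrightarrow> star u * u = 1 \<and> u * star u = 1"

definition spectrum :: "'a::unital_cstar_algebra \<Rightarrow> complex set" where
  "spectrum a = {z. \<not> invertible_elt (z *\<^sub>C 1 - a)}"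

definition pos_inv :: "'a::unital_cstar_algebra set" where
  "pos_inv = {a. star a = a \<and> spectrum a \<subseteq> complex_of_real ` {0..} \<and> invertible_elt a}"

definition poly_at :: "real poly \<Rightarrow> 'a::unital_cstar_algebra \<Rightarrow> 'a" where
  "poly_at p a = (\<Sum>i\<le>degree p. coeff p i *\<^sub>R a ^ i)"

text \<open>
  Continuous functional calculus \<open>f(a)\<close> of a self-adjoint element \<open>a\<close> and a real function \<open>f\<close>
  continuous on its (compact, real) spectrum: the limit of \<open>p\<^sub>n(a)\<close> for any sequence of polynomials
  \<open>p\<^sub>n\<close> converging to \<open>f\<close> uniformly on the spectrum. It is only meaningful for such \<open>a\<close> and \<open>f\<close>.
\<close>

definition cfc :: "(real \<Rightarrow> real) \<Rightarrow> 'a::unital_cstar_algebra \<Rightarrow> 'a" where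
  "cfc f a = (THE b. \<forall>p :: nat \<Rightarrow> real poly.
      uniform_limit {x. complex_of_real x \<in> spectrum a} (\<lambda>n. poly (p n)) f sequentially
      \<longrightarrow> (\<lambda>n. poly_at (p n) a) \<longlonglongrightarrow> b)"

definition pow_elt :: "'a::unital_cstar_algebra \<Rightarrow> real \<Rightarrow> 'a" where
  "pow_elt a t = cfc (\<lambda>x. x powr t) a"

definition log_elt :: "'a::unital_cstar_algebra \<Rightarrow> 'a" where
  "log_elt a = cfc ln a"

definition pdist :: "'a::unital_cstar_algebra \<Rightarrow> 'a \<Rightarrow> real" where
  "pdist a b = norm (log_elt (pow_elt a (-1/2) * b * pow_elt a (-1/2)))"

definition geodesic :: "'a::unital_cstar_algebra \<Rightarrow> 'a \<Rightarrow> real \<Rightarrow> 'a" where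
  "geodesic a b t =
     pow_elt a (1/2) * pow_elt (pow_elt a (-1/2) * b * pow_elt a (-1/2)) t * pow_elt a (1/2)"

definition invertible_group :: "'a::ring_1 set \<Rightarrow> bool" where
  "invertible_group H \<longleftrightarrow> 1 \<in> H \<and> (\<forall>g\<in>H. \<forall>h\<in>H. g * h \<in> H) \<and>
     (\<forall>h\<in>H. invertible_elt h \<and> inv_elt h \<in> H)"

definition pos_fixed :: "'a::unital_cstar_algebra set \<Rightarrow> 'a set" where
  "pos_fixed H = {a \<in> pos_inv. \<forall>h\<in>H. h * a * star h = a}"

definition pdist_set :: "'a::unital_cstar_algebra \<Rightarrow> 'a set \<Rightarrow> real" where
  "pdist_set a S = (INF b\<in>S. pdist a b)"

definition uniformly_bounded :: "'a::unital_cstar_algebra set \<Rightarrow> bool" where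
  "uniformly_bounded H \<longleftrightarrow> bdd_above (norm ` H)"

definition group_size :: "'a::unital_cstar_algebra set \<Rightarrow> real" where
  "group_size H = (SUP h\<in>H. norm h)"

definition conj_group :: "'a::ring_1 \<Rightarrow> 'a set \<Rightarrow> 'a set" where
  "conj_group s H = (\<lambda>h. inv_elt s * h * s) ` H"

definition unitarizer :: "'a::unital_cstar_algebra \<Rightarrow> 'a set \<Rightarrow> bool" where
  "unitarizer s H \<longleftrightarrow> invertible_elt s \<and> (\<forall>u\<in>conj_group s H. unitary u)"

definition unitarizable :: "'a::unital_cstar_algebra set \<Rightarrow> bool" where
  "unitarizable H \<longleftrightarrow> (\<exists>s. unitarizer s H)"

definition sim :: "'a::unital_cstar_algebra set \<Rightarrow> real" where
  "sim H = Inf {norm s * norm (inv_elt s) | s. unitarizer s H}"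

text \<open>\<open>a\<^sup>-\<^sup>t H a\<^sup>t\<close> for positive invertible \<open>a\<close> and real \<open>t\<close>.\<close>

definition pow_conj_group :: "'a::unital_cstar_algebra \<Rightarrow> real \<Rightarrow> 'a set \<Rightarrow> 'a set" where
  "pow_conj_group a t H = (\<lambda>h. pow_elt a (-t) * h * pow_elt a t) ` H"

end

theory Submission
  imports Defs "HOL-Computational_Algebra.Fundamental_Theorem_Algebra"
begin

text \<open>
  Let \<open>\<gamma>\<^sub>t\<close> be the geodesic from \<open>a\<close> to \<open>b\<close>. It has the form \<open>\<gamma>\<^sub>t = zz\<^sup>*\<close> with \<open>z = a\<^sup>1\<^sup>/\<^sup>2 x\<^sup>t\<close>,
  where \<open>x\<close> is the square root of \<open>a\<^sup>-\<^sup>1\<^sup>/\<^sup>2 b a\<^sup>-\<^sup>1\<^sup>/\<^sup>2\<close>, and \<open>\<gamma>\<^sub>t\<^sup>1\<^sup>/\<^sup>2\<close> is \<open>z\<close> times a unitary. If a second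
  geodesic \<open>\<gamma>'\<^sub>t\<close> is factorized in the same way with \<open>c\<close> and \<open>y\<close>, then
  \<open>norm (\<gamma>\<^sub>t\<^sup>-\<^sup>1\<^sup>/\<^sup>2 h \<gamma>'\<^sub>t\<^sup>1\<^sup>/\<^sup>2) = norm (x\<^sup>-\<^sup>t g y\<^sup>t)\<close> with a fixed \<open>g = a\<^sup>-\<^sup>1\<^sup>/\<^sup>2 h c\<^sup>1\<^sup>/\<^sup>2\<close>. All
  inequalities come from the fact that this is a log-convex function of \<open>t\<close>
  (\<open>norm_pow_elt_log_convex\<close>, \<open>norm_between_geodesics_log_convex\<close>).

  Log-convexity can be seen without complex interpolation. For \<open>T = x\<^sup>m g y\<^sup>m\<close> at a midpoint
  \<open>m = (s + t) / 2\<close>, a cyclic rearrangement of the factors of \<open>T\<^sup>*T\<close> is the product of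
  \<open>(x\<^sup>s g y\<^sup>s)\<^sup>*\<close> and \<open>x\<^sup>t g y\<^sup>t\<close>. The norm of a self-adjoint element is attained on its
  spectrum, whose nonzero part is invariant under cyclic rearrangements; so \<open>(norm T)\<^sup>2\<close> is at
  most the norm of this product. A bounded midpoint log-convex function is bounded by the log-affine
  function with the same end values.

  For \<open>\<gamma> = \<gamma>'\<close> and \<open>h \<in> H\<close> this is the inequality for group sizes. For the similarity number, an
  invertible \<open>s\<close> is a unitarizer of \<open>H\<close> if and only if \<open>ss\<^sup>*\<close> is a fixed point of \<open>H\<close>, and a
  geodesic between two fixed points consists of fixed points (\<open>geodesic_pos_fixed\<close>). With \<open>h = 1\<close>
  and \<open>\<gamma>'\<close> such a geodesic, \<open>\<gamma>\<^sub>t\<^sup>-\<^sup>1\<^sup>/\<^sup>2 \<gamma>'\<^sub>t\<^sup>1\<^sup>/\<^sup>2\<close> unitarizes the group at time \<open>t\<close>, and log-convexity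
  bounds its norm and the norm of its inverse.

  In the last part the upper bounds are those for the geodesic from \<open>1\<close> to \<open>s\<^sup>2\<close>, where the group at
  the end consists of unitaries. For the lower bound, the scalar multiple of a unitarizer \<open>u\<close> whose
  norm equals that of its inverse shows that the distance from \<open>1\<close> to the fixed points is at most
  the logarithm of \<open>norm u * norm u\<^sup>-\<^sup>1\<close>. So if \<open>s\<close> attains the distance, then
  \<open>norm s\<^sup>t * norm s\<^sup>-\<^sup>t \<le> sim H powr t\<close>, and passing from \<open>H\<close> to \<open>s\<^sup>-\<^sup>tHs\<^sup>t\<close> divides the similarity
  number by at most this factor.

  The underlying theory of C*-algebras rests on one fact: the norm of a self-adjoint element is the
  absolute value of a point of its spectrum (\<open>norm_in_real_spectrum\<close>). It is derived from the
  C*-identity and square roots of elements near \<open>1\<close>, which are found by iteration. It gives the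
  norm estimate for polynomials, hence the continuous functional calculus, and the positivity of
  \<open>xx\<^sup>*\<close>.
\<close>

section \<open>Inverses\<close>

lemma inv_eltI:
  assumes "a * b = 1" "b * a = 1"
  shows "invertible_elt a" "inv_elt a = b"
proof -
  have ab: "is_inverse a b"
    using assms by (simp add: is_inverse_def)
  then show "invertible_elt a"
    by (auto simp: invertible_elt_def)
  show "inv_elt a = b"
    unfolding inv_elt_def
  proof (rule the_equality)
    fix c assume "is_inverse a c"
    then have "c = (b * a) * c" and "a * c = 1"
      using assms by (auto simp: is_inverse_def)
    then show "c = b"
      by (simp add: mult.assoc)
  qed (fact ab)
qed

lemma inv_elt_mult [simp]:
  assumes "invertible_elt a"
  shows "a * inv_elt a = 1" "inv_elt a * a = 1"
  using assms inv_eltI unfolding invertible_elt_def is_inverse_def by metis+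

lemma invertible_inv_elt:
  assumes "invertible_elt a"
  shows "invertible_elt (inv_elt a)" "inv_elt (inv_elt a) = a"
  using inv_eltI[of "inv_elt a" a] assms by simp_all

lemma mult_inverse_mult:
  fixes a :: "'a::ring_1"
  assumes "a * a' = 1" "b * b' = 1"
  shows "(a * b) * (b' * a') = 1"
proof -
  have "(a * b) * (b' * a') = a * (b * b') * a'"
    by (simp add: mult.assoc)
  then show ?thesis
    using assms by simp
qed

lemma invertible_mult:
  assumes "invertible_elt a" "invertible_elt b"
  shows "invertible_elt (a * b)" "inv_elt (a * b) = inv_elt b * inv_elt a"
  using inv_eltI[of "a * b" "inv_elt b * inv_elt a"] assms
  by (simp_all add: mult_inverse_mult)

lemma invertible_factor:
  fixes a b :: "'a::ring_1"
  assumes "invertible_elt (a * b)" "a * b = b * a"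
  shows "invertible_elt a"
proof -
  define c where "c = inv_elt (a * b)"
  have c: "(a * b) * c = 1" "c * (a * b) = 1"
    using assms(1) by (simp_all add: c_def)
  have r: "a * (b * c) = 1"
    using c(1) by (simp add: mult.assoc)
  have l: "(c * b) * a = 1"
    using c(2) assms(2) by (simp add: mult.assoc)
  have "c * b = (c * b) * (a * (b * c))"
    by (simp only: r mult_1_right)
  also have "\<dots> = ((c * b) * a) * (b * c)"
    by (simp only: mult.assoc)
  finally have "c * b = b * c"
    by (simp add: l)
  with r l show ?thesis
    by (intro inv_eltI(1)[of a "b * c"]) auto
qed

lemma invertible_scaleR_iff:
  fixes a :: "'a::real_algebra_1"
  assumes "c \<noteq> 0"
  shows "invertible_elt (c *\<^sub>R a) \<longleftrightarrow> invertible_elt a"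
proof -
  have *: "invertible_elt (c *\<^sub>R a)" if "invertible_elt a" "c \<noteq> 0" for c and a :: 'a
    using that by (intro inv_eltI(1)[of _ "inverse c *\<^sub>R inv_elt a"]) auto
  show ?thesis
    using *[of a c] *[of "c *\<^sub>R a" "inverse c"] assms by auto
qed

lemma invertible_uminus_iff:
  fixes a :: "'a::real_algebra_1"
  shows "invertible_elt (- a) \<longleftrightarrow> invertible_elt a"
  using invertible_scaleR_iff[of "-1" a] by simp

lemma inverse_commute:
  fixes a :: "'a::ring_1"
  assumes "a * b = 1" "b * a = 1" "x * a = a * x"
  shows "x * b = b * x"
proof -
  have "x * b = (b * a) * (x * b)"
    using assms by simp
  also have "\<dots> = b * (a * x) * b"
    by (simp only: mult.assoc)
  also have "\<dots> = b * x * (a * b)"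
    by (simp only: assms(3)[symmetric] mult.assoc)
  finally show ?thesis
    using assms by simp
qed

lemma invertible_one_minus:
  fixes c :: "'a::{real_normed_algebra_1,banach}"
  assumes "norm c < 1"
  shows "invertible_elt (1 - c)"
proof -
  have sm: "summable (\<lambda>n. c ^ n)"
    by (rule summable_comparison_test'[of "\<lambda>n. norm c ^ n"])
      (use assms in \<open>auto simp: norm_power_ineq intro: summable_geometric\<close>)
  let ?S = "\<Sum>n. c ^ n"
  have "(\<Sum>n. c ^ Suc n) = ?S - 1"
    using suminf_split_head[OF sm] by simp
  moreover have "(\<Sum>n. c ^ Suc n) = c * ?S"
    using suminf_mult[OF sm, of c] by simp
  moreover have "(\<Sum>n. c ^ Suc n) = ?S * c"
    using suminf_mult2[OF sm, of c] by (simp add: power_commutes)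
  ultimately show ?thesis
    by (intro inv_eltI(1)[of _ ?S]) (auto simp: algebra_simps)
qed

lemma invertible_scalar_minus:
  fixes c :: "'a::{real_normed_algebra_1,banach}"
  assumes "norm c < t"
  shows "invertible_elt (t *\<^sub>R 1 - c)"
proof -
  have t: "t > 0"
    using assms norm_ge_zero[of c] by linarith
  have "invertible_elt (1 - inverse t *\<^sub>R c)"
    using assms t by (intro invertible_one_minus) (simp add: field_simps)
  then have "invertible_elt (t *\<^sub>R (1 - inverse t *\<^sub>R c))"
    using t by (subst invertible_scaleR_iff) auto
  then show ?thesis
    using t by (simp add: scaleR_diff_right)
qed

lemma noninvertible_limit:
  fixes a :: "nat \<Rightarrow> 'a::{real_normed_algebra_1,banach}"
  assumes lim: "a \<longlonglongrightarrow> b" and ni: "\<And>n. \<not> invertible_elt (a n)"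
  shows "\<not> invertible_elt b"
proof
  assume b: "invertible_elt b"
  let ?d = "inv_elt b"
  have "(\<lambda>n. ?d * (b - a n)) \<longlonglongrightarrow> ?d * (b - b)"
    by (intro tendsto_intros lim)
  then have "eventually (\<lambda>n. norm (?d * (b - a n)) < 1) sequentially"
    using order_tendstoD(2)[OF tendsto_norm, of _ 0 _ 1] by simp
  then obtain n where "norm (?d * (b - a n)) < 1"
    by (auto simp: eventually_sequentially)
  then have "invertible_elt (b * (1 - ?d * (b - a n)))"
    by (intro invertible_mult b invertible_one_minus)
  moreover have "b * (1 - ?d * (b - a n)) = a n"
  proof -
    have "b * (1 - ?d * (b - a n)) = b - (b * ?d) * (b - a n)"
      by (simp add: right_diff_distrib mult.assoc)
    then show ?thesis
      using b by simp
  qed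
  ultimately show False
    using ni by simp
qed

section \<open>The involution\<close>

lemma bounded_linear_scaleC: "bounded_linear (\<lambda>a::'a::unital_cstar_algebra. z *\<^sub>C a)"
proof (rule bounded_linear_intro[where K = "cmod z"])
  fix a b :: 'a and t :: real
  show "z *\<^sub>C (a + b) = z *\<^sub>C a + z *\<^sub>C b"
    by (rule scaleC_add_right)
  have "z *\<^sub>C (t *\<^sub>R a) = complex_of_real t *\<^sub>C z *\<^sub>C a"
    by (metis scaleC_of_real scaleC_scaleC mult.commute)
  then show "z *\<^sub>C (t *\<^sub>R a) = t *\<^sub>R z *\<^sub>C a"
    by (simp add: scaleC_of_real)
qed (simp add: norm_scaleC mult.commute)

lemmas scaleC_diff_right = bounded_linear.linear[OF bounded_linear_scaleC, THEN linear_diff]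

lemma norm_star [simp]:
  fixes a :: "'a::unital_cstar_algebra"
  shows "norm (star a) = norm a"
proof -
  have le: "norm a \<le> norm (star a)" for a :: 'a
  proof (cases "a = 0")
    case False
    have "norm a * norm a = norm (star a * a)"
      by (simp add: cstar_identity power2_eq_square)
    also have "\<dots> \<le> norm (star a) * norm a"
      by (rule norm_mult_ineq)
    finally show ?thesis
      using False by simp
  qed simp
  show ?thesis
    using le[of a] le[of "star a"] by (simp add: star_star)
qed

lemma bounded_linear_star: "bounded_linear (star :: 'a::unital_cstar_algebra \<Rightarrow> 'a)"
proof (rule bounded_linear_intro[where K = 1])
  show "star (t *\<^sub>R a) = t *\<^sub>R star a" for t and a :: 'a
    using star_scaleC[of "complex_of_real t" a] by (simp add: scaleC_of_real)
qed (simp_all add: star_add)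

lemmas star_scaleR [simp] = bounded_linear.linear[OF bounded_linear_star, THEN linear_scale]
lemmas star_diff = bounded_linear.linear[OF bounded_linear_star, THEN linear_diff]
lemmas star_minus [simp] = bounded_linear.linear[OF bounded_linear_star, THEN linear_neg]
lemmas star_zero [simp] = bounded_linear.linear[OF bounded_linear_star, THEN linear_0]
lemmas tendsto_star = bounded_linear.tendsto[OF bounded_linear_star]

lemma star_one [simp]: "star (1::'a::unital_cstar_algebra) = 1"
proof -
  have "star (1::'a) = star (star (star 1 * 1))"
    by (simp add: star_star)
  also have "\<dots> = star (star 1 * star (star 1))"
    by (simp only: star_mult)
  finally show ?thesis
    by (simp add: star_star)
qed

lemma cstar_identity': "norm (a * star a) = (norm (a::'a::unital_cstar_algebra))\<^sup>2"
  using cstar_identity[of "star a"] by (simp add: star_star)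

lemma norm_square_selfadjoint:
  "star a = a \<Longrightarrow> norm (a * a) = (norm (a::'a::unital_cstar_algebra))\<^sup>2"
  using cstar_identity[of a] by simp

lemma star_inverse:
  fixes a :: "'a::unital_cstar_algebra"
  assumes "invertible_elt a"
  shows "invertible_elt (star a)" "inv_elt (star a) = star (inv_elt a)"
  using inv_eltI[of "star a" "star (inv_elt a)"] assms
  by (simp_all flip: star_mult)

section \<open>Square roots near the unit and the spectrum of self-adjoint elements\<close>

text \<open>
  A root \<open>1 - y\<close> of \<open>1 - c\<close> is a solution of \<open>y = (c + y\<^sup>2) / 2\<close>. The right-hand side is a
  contraction of the ball of radius \<open>1 - sqrt (1 - norm c) < 1\<close>, and it preserves the closed set
  of self-adjoint elements which commute with everything that commutes with \<open>c\<close>.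
\<close>

lemma sqrt_one_minus:
  fixes c :: "'a::unital_cstar_algebra"
  assumes "star c = c" "norm c < 1"
  obtains w where "star w = w" "w * w = 1 - c" "\<And>d. d * c = c * d \<Longrightarrow> d * w = w * d"
proof -
  define \<rho> where "\<rho> = 1 - sqrt (1 - norm c)"
  have \<rho>0: "0 \<le> \<rho>" and \<rho>1: "\<rho> < 1"
    using assms(2) by (auto simp: \<rho>_def)
  have \<rho>: "norm c + \<rho> * \<rho> = 2 * \<rho>"
    using assms(2) by (simp add: \<rho>_def algebra_simps)
  define S where "S = {y. star y = y \<and> norm y \<le> \<rho> \<and> (\<forall>d. d * c = c * d \<longrightarrow> d * y = y * d)}"
  define f where "f y = (1/2) *\<^sub>R (c + y * y)" for y
  have "closed S"
    unfolding S_def Collect_conj_eq Collect_all_eq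
    by (intro closed_Int closed_INT ballI closed_Collect_eq closed_Collect_le closed_Collect_imp open_Collect_const
        continuous_intros bounded_linear.continuous_on[OF bounded_linear_star])
  then have "complete S"
    by (simp add: complete_eq_closed)
  moreover have "S \<noteq> {}"
    using \<rho>0 by (auto simp: S_def intro!: exI[of _ 0])
  moreover have "f ` S \<subseteq> S"
  proof
    fix z assume "z \<in> f ` S"
    then obtain y where y: "y \<in> S" "z = f y"
      by auto
    have "norm (y * y) \<le> \<rho> * \<rho>"
      using y \<rho>0 by (intro order_trans[OF norm_mult_ineq] mult_mono) (auto simp: S_def)
    then have "norm (f y) \<le> \<rho>"
      using norm_triangle_ineq[of c "y * y"] \<rho> unfolding f_def by simp
    moreover have "d * f y = f y * d" if "d * c = c * d" for d
    proof -
      have "d * y = y * d"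
        using that y(1) unfolding S_def by blast
      then have "d * (y * y) = y * y * d"
        by (metis mult.assoc)
      with that show ?thesis
        by (simp add: f_def distrib_left distrib_right)
    qed
    moreover have "star y = y"
      using y(1) unfolding S_def by blast
    then have "star (f y) = f y"
      using assms(1) by (simp add: f_def star_mult star_add)
    ultimately show "z \<in> S"
      unfolding S_def y(2) by blast
  qed
  moreover have "dist (f x) (f y) \<le> \<rho> * dist x y" if "x \<in> S" "y \<in> S" for x y
  proof -
    have "f x - f y = (1/2) *\<^sub>R (x * (x - y) + (x - y) * y)"
      by (simp add: f_def algebra_simps)
    then have "norm (f x - f y) = norm (x * (x - y) + (x - y) * y) / 2"
      by simp
    also have "norm (x * (x - y) + (x - y) * y) \<le> \<rho> * norm (x - y) + norm (x - y) * \<rho>"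
      using that \<rho>0
      by (intro norm_triangle_mono order_trans[OF norm_mult_ineq] mult_mono) (auto simp: S_def)
    finally show ?thesis
      by (simp add: dist_norm)
  qed
  ultimately obtain y where y: "y \<in> S" "f y = y"
    using Banach_fix[of S \<rho> f] \<rho>0 \<rho>1 by blast
  have "c + y * y = 2 *\<^sub>R f y"
    by (simp add: f_def)
  then have "c + y * y = y + y"
    by (simp add: y(2) scaleR_2)
  then have "(1 - y) * (1 - y) = 1 - c"
    by (simp add: algebra_simps)
  moreover have "d * y = y * d" if "d * c = c * d" for d
    using y(1) that unfolding S_def by blast
  then have "d * (1 - y) = (1 - y) * d" if "d * c = c * d" for d
    using that by (simp add: left_diff_distrib right_diff_distrib)
  moreover have "star y = y"
    using y(1) unfolding S_def by blast
  then have "star (1 - y) = 1 - y"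
    by (simp add: star_diff)
  ultimately show ?thesis
    using that by blast
qed

text \<open>
  If \<open>b\<close> and \<open>w\<close> are commuting self-adjoint elements with \<open>b\<^sup>2 + w\<^sup>2 = \<sigma>\<close>, then \<open>u = b + \<i>w\<close>
  is \<open>sqrt \<sigma>\<close> times a unitary, and \<open>b\<close> is its real part.
\<close>

lemma norm_le_if_sum_squares:
  fixes b w :: "'a::unital_cstar_algebra"
  assumes sa: "star b = b" "star w = w" and comm: "b * w = w * b"
    and sum: "b * b + w * w = \<sigma> *\<^sub>R 1" and "\<sigma> \<ge> 0"
  shows "(norm b)\<^sup>2 \<le> \<sigma>"
proof -
  define u where "u = b + \<i> *\<^sub>C w"
  have su: "star u = b + (- \<i>) *\<^sub>C w"
    by (simp add: u_def star_add star_scaleC sa)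
  have iw: "\<i> *\<^sub>C w + (- \<i>) *\<^sub>C w = 0"
    using scaleC_add_left[of \<i> "- \<i>" w] scaleC_of_real[of 0 w] by simp
  have "star u * u = b * b + (- \<i> * \<i>) *\<^sub>C (w * w) + (\<i> *\<^sub>C (b * w) + (- \<i>) *\<^sub>C (w * b))"
    unfolding su unfolding u_def distrib_left distrib_right mult_scaleC_left mult_scaleC_right scaleC_add_right scaleC_scaleC
    by (simp add: ac_simps)
  also have "(- \<i> * \<i>) *\<^sub>C (w * w) = w * w"
    using scaleC_of_real[of 1 "w * w"] by simp
  also have "\<i> *\<^sub>C (b * w) + (- \<i>) *\<^sub>C (w * b) = 0"
    using scaleC_add_left[of \<i> "- \<i>" "w * b"] scaleC_of_real[of 0 "w * b"] comm by simp
  finally have "(norm u)\<^sup>2 = \<sigma>"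
    using sum cstar_identity[of u] \<open>\<sigma> \<ge> 0\<close> by simp
  moreover have "u + star u = 2 *\<^sub>R b"
    using iw unfolding su unfolding u_def scaleR_2 by (simp add: algebra_simps)
  then have "2 * norm b \<le> norm u + norm (star u)"
    using norm_triangle_ineq[of u "star u"] by simp
  ultimately show ?thesis
    by (metis norm_star mult_2 mult_le_cancel_left_pos norm_ge_zero power_mono zero_less_numeral)
qed

text \<open>
  This expresses \<open>0 \<le> b\<^sup>2 \<le> \<tau>\<close> without an order. The slack \<open>\<epsilon>\<close> makes \<open>1 - b\<^sup>2 / (\<tau> + \<epsilon>)\<close> a square \<open>w\<^sup>2\<close>,
  and \<open>w\<^sup>2 + b\<^sup>2 / (\<tau> + \<epsilon>) = 1\<close> bounds \<open>w\<close>.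
\<close>

lemma norm_scalar_minus_square:
  fixes b :: "'a::unital_cstar_algebra"
  assumes sa: "star b = b" and "(norm b)\<^sup>2 \<le> \<tau>"
  shows "norm (\<tau> *\<^sub>R 1 - b * b) \<le> \<tau>"
proof (rule field_le_epsilon)
  fix e :: real assume "e > 0"
  define \<epsilon> where "\<epsilon> = e / 2"
  have \<epsilon>: "\<epsilon> > 0" "\<tau> + \<epsilon> > 0"
    using \<open>e > 0\<close> order_trans[OF zero_le_power2 assms(2)] by (auto simp: \<epsilon>_def)
  define c where "c = inverse (\<tau> + \<epsilon>) *\<^sub>R (b * b)"
  have "norm c = inverse (\<tau> + \<epsilon>) * (norm b)\<^sup>2"
    using \<epsilon> by (simp add: c_def norm_square_selfadjoint sa)
  also have "\<dots> < 1"
    using \<epsilon> assms(2) by (simp add: field_simps)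
  finally have "norm c < 1" .
  moreover have "star c = c"
    by (simp add: c_def star_mult sa)
  ultimately obtain w where w: "star w = w" "w * w = 1 - c" "\<And>d. d * c = c * d \<Longrightarrow> d * w = w * d"
    using sqrt_one_minus[of c] by blast
  have "b * w = w * b"
    by (rule w(3)) (simp add: c_def mult.assoc)
  moreover have bb: "b * b = (\<tau> + \<epsilon>) *\<^sub>R c"
    using \<epsilon> by (simp add: c_def)
  define t where "t = sqrt (inverse (\<tau> + \<epsilon>))"
  have t: "t * t = inverse (\<tau> + \<epsilon>)"
    using \<epsilon> by (simp add: t_def)
  have "w * w + (t *\<^sub>R b) * (t *\<^sub>R b) = 1 *\<^sub>R 1"
    using w(2) by (simp add: t c_def)
  ultimately have "(norm w)\<^sup>2 \<le> 1"
    using norm_le_if_sum_squares[of w "t *\<^sub>R b" 1] w(1) sa by simp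
  then have "norm (1 - c) \<le> 1"
    using norm_square_selfadjoint[of w] w(1,2) by simp
  then have "(\<tau> + \<epsilon>) * norm (1 - c) \<le> \<tau> + \<epsilon>"
    using \<epsilon> by (simp add: mult_le_cancel_left1)
  also have "(\<tau> + \<epsilon>) * norm (1 - c) = norm ((\<tau> + \<epsilon>) *\<^sub>R (1 - c))"
    using \<epsilon> by simp
  also have "(\<tau> + \<epsilon>) *\<^sub>R (1 - c) = (\<tau> *\<^sub>R 1 - b * b) + \<epsilon> *\<^sub>R 1"
    by (simp add: bb algebra_simps)
  finally have "norm ((\<tau> *\<^sub>R 1 - b * b) + \<epsilon> *\<^sub>R 1) \<le> \<tau> + \<epsilon>" .
  then have "norm (\<tau> *\<^sub>R 1 - b * b) \<le> \<tau> + \<epsilon> + \<epsilon>"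
    using norm_triangle_ineq4[of "(\<tau> *\<^sub>R 1 - b * b) + \<epsilon> *\<^sub>R 1" "\<epsilon> *\<^sub>R 1"] \<epsilon> by simp
  then show "norm (\<tau> *\<^sub>R 1 - b * b) \<le> \<tau> + e"
    by (simp add: \<epsilon>_def)
qed

text \<open>The square \<open>b\<^sup>2\<close> is within \<open>\<tau> = (norm b)\<^sup>2\<close> of \<open>\<tau>\<close>, so that \<open>b\<^sup>2 + t\<close> is within \<open>\<tau>\<close> of \<open>\<tau> + t\<close>.\<close>

lemma invertible_square_plus:
  fixes b :: "'a::unital_cstar_algebra"
  assumes "star b = b" "t > 0"
  shows "invertible_elt (b * b + t *\<^sub>R 1)"
proof -
  let ?\<tau> = "(norm b)\<^sup>2"
  have "norm (?\<tau> *\<^sub>R 1 - b * b) < ?\<tau> + t"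
    using norm_scalar_minus_square[OF assms(1), of ?\<tau>] assms(2) by simp
  from invertible_scalar_minus[OF this] show ?thesis
    by (simp add: algebra_simps)
qed

text \<open>
  For self-adjoint \<open>a\<close> this is the whole spectrum, as a set of reals: the domain of the functions
  which can be applied to \<open>a\<close>.
\<close>

definition real_spectrum :: "'a::unital_cstar_algebra \<Rightarrow> real set" where
  "real_spectrum a = {x. complex_of_real x \<in> spectrum a}"

lemma real_spectrum_iff: "x \<in> real_spectrum a \<longleftrightarrow> \<not> invertible_elt (x *\<^sub>R 1 - a)"
  by (simp add: real_spectrum_def spectrum_def scaleC_of_real)

lemma invertible_selfadjoint_minus_nonreal:
  fixes a :: "'a::unital_cstar_algebra"
  assumes "star a = a" "Im z \<noteq> 0"
  shows "invertible_elt (a * a - (2 * Re z) *\<^sub>R a + (cmod z)\<^sup>2 *\<^sub>R 1)"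
proof -
  have "invertible_elt ((a - Re z *\<^sub>R 1) * (a - Re z *\<^sub>R 1) + (Im z)\<^sup>2 *\<^sub>R 1)"
    using assms by (intro invertible_square_plus) (auto simp: star_diff)
  moreover have "(a - Re z *\<^sub>R 1) * (a - Re z *\<^sub>R 1) + (Im z)\<^sup>2 *\<^sub>R 1
      = a * a - (2 * Re z) *\<^sub>R a + (cmod z)\<^sup>2 *\<^sub>R 1"
  proof -
    have "(2 * Re z) *\<^sub>R a = Re z *\<^sub>R a + Re z *\<^sub>R a"
      by (simp flip: scaleR_add_left)
    moreover have "(cmod z)\<^sup>2 *\<^sub>R (1::'a) = (Re z * Re z) *\<^sub>R 1 + (Im z)\<^sup>2 *\<^sub>R 1"
      by (simp only: cmod_power2 power2_eq_square[of "Re z"] scaleR_add_left)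
    moreover have "(a - Re z *\<^sub>R 1) * (a - Re z *\<^sub>R 1)
        = a * a - (Re z *\<^sub>R a + Re z *\<^sub>R a) + (Re z * Re z) *\<^sub>R 1"
      by (simp add: left_diff_distrib right_diff_distrib scaleR_diff_right)
    ultimately show ?thesis
      by (simp only: add.assoc)
  qed
  ultimately show ?thesis
    by simp
qed

text \<open>
  For nonreal \<open>z\<close>, the product of \<open>z - a\<close> and \<open>cnj z - a\<close> is \<open>(a - Re z)\<^sup>2 + (Im z)\<^sup>2\<close>, which is
  invertible.
\<close>

lemma spectrum_selfadjoint:
  fixes a :: "'a::unital_cstar_algebra"
  assumes sa: "star a = a"
  shows "spectrum a = complex_of_real ` real_spectrum a"
proof -
  have "Im z = 0" if "z \<in> spectrum a" for z
  proof (rule ccontr)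
    assume z: "Im z \<noteq> 0"
    have sum: "z *\<^sub>C (1::'a) + cnj z *\<^sub>C 1 = (2 * Re z) *\<^sub>R 1"
      using scaleC_of_real[of "2 * Re z" "1::'a"]
      by (simp add: complex_add_cnj flip: scaleC_add_left)
    have prod: "(z * cnj z) *\<^sub>C (1::'a) = (cmod z)\<^sup>2 *\<^sub>R 1"
      using scaleC_of_real[of "(cmod z)\<^sup>2" "1::'a"] 
      by (simp only: complex_norm_square)
    have *: "(x *\<^sub>C 1 - a) * (y *\<^sub>C 1 - a) = (x * y) *\<^sub>C 1 - (x *\<^sub>C 1 + y *\<^sub>C 1) * a + a * a" for x y
      by (simp add: algebra_simps mult_scaleC_left mult_scaleC_right scaleC_scaleC scaleC_diff_right)
    have eq: "(z *\<^sub>C 1 - a) * (cnj z *\<^sub>C 1 - a)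
        = a * a - (2 * Re z) *\<^sub>R a + (cmod z)\<^sup>2 *\<^sub>R 1"
      unfolding * by (simp add: sum prod)
    then have "invertible_elt ((z *\<^sub>C 1 - a) * (cnj z *\<^sub>C 1 - a))"
      using invertible_selfadjoint_minus_nonreal[OF sa z] by (simp only:)
    moreover have "(z *\<^sub>C 1 - a) * (cnj z *\<^sub>C 1 - a) = (cnj z *\<^sub>C 1 - a) * (z *\<^sub>C 1 - a)"
      unfolding * by (simp add: mult.commute add.commute)
    ultimately have "invertible_elt (z *\<^sub>C 1 - a)"
      by (rule invertible_factor)
    then show False
      using that by (simp add: spectrum_def)
  qed
  then have *: "z = complex_of_real (Re z)" if "z \<in> spectrum a" for z
    using that by (simp add: complex_eq_iff)
  show ?thesis
  proof
    show "spectrum a \<subseteq> complex_of_real ` real_spectrum a"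
    proof
      fix z assume "z \<in> spectrum a"
      with *[OF this] show "z \<in> complex_of_real ` real_spectrum a"
        unfolding real_spectrum_def by (intro image_eqI[of _ _ "Re z"]) simp_all
    qed
  qed (auto simp: real_spectrum_def)
qed

text \<open>
  Suppose that \<open>1 - b\<^sup>2\<close> has an inverse \<open>d\<close>. Heuristically \<open>1 - b\<^sup>2 \<ge> \<delta>\<close> for a \<open>\<delta> > 0\<close>, so that
  \<open>norm b < 1\<close>. Indeed, for \<open>\<epsilon>\<close> small the element \<open>e = 1 + \<epsilon> - b\<^sup>2\<close> is a square \<open>w\<^sup>2\<close> with inverse
  \<open>d'\<close> bounded by \<open>2 * norm d\<close>, and \<open>1 - \<delta>d'\<close> is a square \<open>v\<^sup>2\<close>; then
  \<open>b\<^sup>2 + (wv)\<^sup>2 = 1 + \<epsilon> - \<delta>\<close>, and \<open>norm_le_if_sum_squares\<close> bounds \<open>b\<close>.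
\<close>

lemma not_invertible_one_minus_square:
  fixes b :: "'a::unital_cstar_algebra"
  assumes sa: "star b = b" and nb: "norm b = 1"
  shows "\<not> invertible_elt (1 - b * b)"
proof
  assume inv: "invertible_elt (1 - b * b)"
  define d where "d = inv_elt (1 - b * b)"
  have d: "(1 - b * b) * d = 1" "d * (1 - b * b) = 1"
    using inv by (simp_all add: d_def)
  have "d \<noteq> 0"
    using d by auto
  \<comment> \<open>With the factor 4, \<open>norm d' \<le> 2 * norm d\<close> gives \<open>norm (\<delta>d') \<le> 1/2\<close>; and \<open>\<epsilon> < \<delta>\<close> is what the
    final contradiction needs.\<close>
  define \<delta> where "\<delta> = 1 / (4 * norm d)"
  define \<epsilon> where "\<epsilon> = \<delta> / 2"
  have pos: "\<delta> > 0" "\<epsilon> > 0" and \<epsilon>d: "\<epsilon> * norm d = 1 / 8" and \<epsilon>\<delta>: "\<epsilon> < \<delta>"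
    using \<open>d \<noteq> 0\<close> by (auto simp: \<delta>_def \<epsilon>_def field_simps)
  define e where "e = (1 + \<epsilon>) *\<^sub>R 1 - b * b"
  have be: "b * e = e * b"
    by (simp add: e_def algebra_simps)
  have "1 - (- \<epsilon> *\<^sub>R d) = d * e"
    using d(2) by (simp add: e_def algebra_simps)
  moreover have "norm (- \<epsilon> *\<^sub>R d) < 1"
    using \<epsilon>d pos by simp
  ultimately have "invertible_elt (d * e)"
    using invertible_one_minus by metis
  then have "invertible_elt ((1 - b * b) * (d * e))"
    by (rule invertible_mult(1)[OF inv])
  moreover have "(1 - b * b) * (d * e) = e"
    using d by (simp flip: mult.assoc)
  ultimately have inve: "invertible_elt e"
    by simp
  define d' where "d' = inv_elt e"
  have d': "e * d' = 1" "d' * e = 1"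
    using inve by (simp_all add: d'_def)
  have "d * (e * d') = d' + \<epsilon> *\<^sub>R (d * d')"
  proof -
    have "d * e = 1 + \<epsilon> *\<^sub>R d"
      using d(2) by (simp add: e_def algebra_simps)
    then show ?thesis
      by (simp add: distrib_right flip: mult.assoc)
  qed
  then have "d - \<epsilon> *\<^sub>R (d * d') = d'"
    by (simp only: d' mult_1_right diff_eq_eq)
  then have "norm d' \<le> norm d + \<epsilon> * norm (d * d')"
    using norm_triangle_ineq4[of d "\<epsilon> *\<^sub>R (d * d')"] pos by simp
  also have "\<epsilon> * norm (d * d') \<le> \<epsilon> * (norm d * norm d')"
    using pos by (intro mult_left_mono norm_mult_ineq) auto
  also have "\<dots> = norm d' / 8"
    using \<epsilon>d by (simp flip: mult.assoc)
  finally have "norm d' \<le> 2 * norm d"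
    using norm_ge_zero[of d'] by linarith
  then have "\<delta> * norm d' \<le> \<delta> * (2 * norm d)"
    using pos by (intro mult_left_mono) auto
  also have "\<dots> < 1"
    using \<open>d \<noteq> 0\<close> by (simp add: \<delta>_def)
  finally have "norm (\<delta> *\<^sub>R d') < 1"
    using pos by simp
  moreover have "star e = e"
    by (simp add: e_def star_diff star_mult sa)
  then have "star (\<delta> *\<^sub>R d') = \<delta> *\<^sub>R d'"
    using star_inverse[OF inve] by (simp add: d'_def)
  ultimately obtain v where v: "star v = v" "v * v = 1 - \<delta> *\<^sub>R d'"
      "\<And>x. x * (\<delta> *\<^sub>R d') = (\<delta> *\<^sub>R d') * x \<Longrightarrow> x * v = v * x"
    using sqrt_one_minus[of "\<delta> *\<^sub>R d'"] by blast
  define t where "t = inverse (1 + \<epsilon>)"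
  have t: "t > 0" "t < 1" "(1 + \<epsilon>) * t = 1"
    using pos by (auto simp: t_def field_simps)
  have "norm (t *\<^sub>R (b * b)) < 1"
    using t nb norm_square_selfadjoint[OF sa] by simp
  moreover have "star (t *\<^sub>R (b * b)) = t *\<^sub>R (b * b)"
    by (simp add: star_mult sa)
  ultimately obtain w0 where w0: "star w0 = w0" "w0 * w0 = 1 - t *\<^sub>R (b * b)"
      "\<And>x. x * (t *\<^sub>R (b * b)) = (t *\<^sub>R (b * b)) * x \<Longrightarrow> x * w0 = w0 * x"
    using sqrt_one_minus[of "t *\<^sub>R (b * b)"] by blast
  define w where "w = sqrt (1 + \<epsilon>) *\<^sub>R w0"
  have "w * w = (1 + \<epsilon>) *\<^sub>R (w0 * w0)"
    using pos by (simp add: w_def)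
  then have ww: "w * w = e"
    using t by (simp add: w0(2) e_def scaleR_diff_right)
  have bw: "b * w = w * b"
    using w0(3)[of b] by (simp add: w_def mult.assoc)
  have we: "w * e = e * w"
    by (simp add: mult.assoc flip: ww)
  have wv: "w * v = v * w"
    by (rule v(3)) (use inverse_commute[OF d' we] in simp)
  have bv: "b * v = v * b"
    by (rule v(3)) (use inverse_commute[OF d' be] in simp)
  have "(w * v) * (w * v) = (w * w) * (v * v)"
    by (metis mult.assoc wv)
  also have "\<dots> = e - \<delta> *\<^sub>R 1"
    using d' by (simp add: ww v(2) right_diff_distrib)
  finally have "b * b + (w * v) * (w * v) = (1 + \<epsilon> - \<delta>) *\<^sub>R 1"
    by (simp add: e_def algebra_simps)
  moreover have "star w = w"
    by (simp add: w_def w0(1))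
  then have "star (w * v) = w * v"
    by (simp add: star_mult v(1) wv)
  moreover have "b * (w * v) = (w * v) * b"
    by (metis bv bw mult.assoc)
  moreover have "1 + \<epsilon> - \<delta> \<ge> 0"
  proof -
    have "1 \<le> 2 * norm d"
    proof -
      have "norm (1 - b * b) \<le> 1"
        using norm_scalar_minus_square[OF sa, of 1] nb by simp
      then have "norm (1 - b * b) * norm d \<le> norm d"
        using mult_right_mono[of "norm (1 - b * b)" 1 "norm d"] by simp
      moreover have "1 \<le> norm (1 - b * b) * norm d"
        using norm_mult_ineq[of "1 - b * b" d] d by simp
      ultimately show ?thesis
        using norm_ge_zero[of d] by linarith
    qed
    then have "\<delta> \<le> 1"
      using \<open>d \<noteq> 0\<close> by (simp add: \<delta>_def field_simps)
    then show ?thesis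
      using pos by simp
  qed
  ultimately have "(norm b)\<^sup>2 \<le> 1 + \<epsilon> - \<delta>"
    using norm_le_if_sum_squares[of b "w * v"] sa by blast
  then show False
    using nb \<epsilon>\<delta> by simp
qed

lemma norm_in_real_spectrum:
  fixes b :: "'a::unital_cstar_algebra"
  assumes sa: "star b = b"
  obtains x where "x \<in> real_spectrum b" "\<bar>x\<bar> = norm b"
proof (cases "b = 0")
  case True
  have "\<not> invertible_elt (0::'a)"
    by (auto simp: invertible_elt_def is_inverse_def)
  then show ?thesis
    using that[of 0] True by (simp add: real_spectrum_iff)
next
  case False
  define n where "n = norm b"
  have n: "n > 0"
    using False by (simp add: n_def)
  let ?c = "inverse n *\<^sub>R b"
  have "\<not> invertible_elt (1 - ?c * ?c)"
    using n sa by (intro not_invertible_one_minus_square) (simp_all add: n_def)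
  moreover have "1 - ?c * ?c = (inverse n * inverse n) *\<^sub>R ((n *\<^sub>R 1 - b) * (n *\<^sub>R 1 + b))"
    using n by (simp add: algebra_simps)
  moreover have "n *\<^sub>R 1 + b = - ((- n) *\<^sub>R 1 - b)"
    by simp
  ultimately have "\<not> invertible_elt (n *\<^sub>R 1 - b) \<or> \<not> invertible_elt ((- n) *\<^sub>R 1 - b)"
    using n by (metis invertible_mult(1) invertible_uminus_iff invertible_scaleR_iff
        mult_eq_0_iff inverse_nonzero_iff_nonzero less_irrefl)
  then show ?thesis
    using that[of n] that[of "- n"] n by (auto simp: real_spectrum_iff n_def)
qed

lemma abs_le_norm_if_in_real_spectrum: "x \<in> real_spectrum a \<Longrightarrow> \<bar>x\<bar> \<le> norm a"
proof (rule ccontr)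
  assume x: "x \<in> real_spectrum a" "\<not> \<bar>x\<bar> \<le> norm a"
  have "invertible_elt (x *\<^sub>R 1 - a)"
  proof (cases "x \<ge> 0")
    case True
    then show ?thesis
      using x by (intro invertible_scalar_minus) auto
  next
    case False
    then have "invertible_elt ((- x) *\<^sub>R 1 - (- a))"
      using x by (intro invertible_scalar_minus) auto
    then show ?thesis
      using invertible_uminus_iff[of "x *\<^sub>R 1 - a"] by simp
  qed
  with x show False
    by (simp add: real_spectrum_iff)
qed

lemma real_spectrum_nonempty:
  "star a = a \<Longrightarrow> real_spectrum a \<noteq> {}"
  by (metis norm_in_real_spectrum empty_iff)

lemma compact_real_spectrum: "compact (real_spectrum a)"
proof -
  have "bounded (real_spectrum a)"
    by (rule boundedI[of _ "norm a"]) (simp add: abs_le_norm_if_in_real_spectrum)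
  moreover have "closed (real_spectrum a)"
    unfolding closed_sequential_limits
  proof (intro allI impI, elim conjE)
    fix x l assume x: "\<forall>n. x n \<in> real_spectrum a" "x \<longlonglongrightarrow> l"
    have "(\<lambda>n. x n *\<^sub>R 1 - a) \<longlonglongrightarrow> l *\<^sub>R 1 - a"
      by (intro tendsto_intros x)
    from noninvertible_limit[OF this] show "l \<in> real_spectrum a"
      using x by (simp add: real_spectrum_iff)
  qed
  ultimately show ?thesis
    by (simp add: compact_eq_bounded_closed)
qed

section \<open>Polynomials of a self-adjoint element\<close>

lemma poly_at_upto:
  "degree p \<le> n \<Longrightarrow> poly_at p a = (\<Sum>i\<le>n. coeff p i *\<^sub>R a ^ i)"
  unfolding poly_at_def by (intro sum.mono_neutral_left) (auto simp: coeff_eq_0)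

lemma poly_at_0 [simp]: "poly_at 0 a = 0"
  by (simp add: poly_at_def)

lemma poly_at_pCons [simp]: "poly_at (pCons c p) a = c *\<^sub>R 1 + a * poly_at p a"
proof -
  have "poly_at (pCons c p) a = (\<Sum>i\<le>Suc (degree p). coeff (pCons c p) i *\<^sub>R a ^ i)"
    by (rule poly_at_upto) (rule degree_pCons_le)
  also have "\<dots> = c *\<^sub>R 1 + a * (\<Sum>i\<le>degree p. coeff p i *\<^sub>R a ^ i)"
    by (simp add: sum.atMost_Suc_shift sum_distrib_left del: sum.atMost_Suc)
  finally show ?thesis
    by (simp add: poly_at_def)
qed

lemma poly_at_add: "poly_at (p + q) a = poly_at p a + poly_at q a"
  by (induction p q rule: poly_induct2) (simp_all add: algebra_simps)

lemma poly_at_smult: "poly_at (smult c p) a = c *\<^sub>R poly_at p a"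
  by (induction p) (simp_all add: algebra_simps)

lemma poly_at_diff: "poly_at (p - q) a = poly_at p a - poly_at q a"
  using poly_at_add[of "p - q" q a] by simp

lemma poly_at_commute:
  assumes "x * a = a * x"
  shows "x * poly_at p a = poly_at p a * x"
proof (induction p)
  case (pCons c p)
  have "x * (a * poly_at p a) = a * poly_at p a * x"
    by (metis assms mult.assoc pCons.IH)
  then show ?case
    by (simp add: distrib_left distrib_right)
qed simp

lemma poly_at_mult: "poly_at (p * q) a = poly_at p a * poly_at q a"
  by (induction p) (simp_all add: poly_at_add poly_at_smult algebra_simps)

lemma star_poly_at:
  assumes "star a = a"
  shows "star (poly_at p a) = poly_at p a"
  by (induction p) (simp_all add: star_add star_mult assms poly_at_commute[symmetric])

lemma poly_at_complex: "poly_at p z = poly (map_poly complex_of_real p) z"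
  by (induction p) (simp_all add: map_poly_pCons scaleR_conv_of_real)

lemma ex_complex_root:
  fixes q :: "real poly"
  assumes "degree q > 0"
  obtains z :: complex where "poly_at q z = 0"
proof -
  have "degree (map_poly complex_of_real q) > 0"
    using assms by (simp add: map_poly_degree_eq degree_map_poly)
  then have "\<not> constant (poly (map_poly complex_of_real q))"
    by (simp add: constant_degree)
  then show ?thesis
    using fundamental_theorem_of_algebra that by (auto simp: poly_at_complex)
qed

text \<open>
  A real root of \<open>q\<close> is not in the spectrum by assumption, and the quadratic factor of a pair of
  nonreal roots is invertible at every self-adjoint element.
\<close>

lemma invertible_poly_at:
  fixes a :: "'a::unital_cstar_algebra"
  assumes sa: "star a = a"
  shows "(\<And>x. x \<in> real_spectrum a \<Longrightarrow> poly q x \<noteq> 0) \<Longrightarrow> invertible_elt (poly_at q a)"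
proof (induction "degree q" arbitrary: q rule: less_induct)
  case less
  have "q \<noteq> 0"
    using less.prems real_spectrum_nonempty[OF sa] by auto
  show ?case
  proof (cases "degree q = 0")
    case True
    then obtain c where "q = [:c:]"
      by (rule degree_eq_zeroE)
    with \<open>q \<noteq> 0\<close> show ?thesis
      by (intro inv_eltI(1)[of _ "inverse c *\<^sub>R 1"]) auto
  next
    case False
    then obtain z :: complex where z: "poly_at q z = 0"
      using ex_complex_root by auto
    have split: "invertible_elt (poly_at q a)"
      if "q = r * d" "degree r > 0" "invertible_elt (poly_at r a)" for r d
    proof -
      have "degree d < degree q"
        using that \<open>q \<noteq> 0\<close> by (auto simp: degree_mult_eq)
      moreover have "poly d x \<noteq> 0" if "x \<in> real_spectrum a" for x
        using less.prems[OF that] \<open>q = r * d\<close> by auto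
      ultimately have "invertible_elt (poly_at d a)"
        by (rule less.hyps)
      moreover have "poly_at q a = poly_at r a * poly_at d a"
        by (simp only: \<open>q = r * d\<close> poly_at_mult)
      ultimately show ?thesis
        using that(3) invertible_mult(1) by metis
    qed
    show ?thesis
    proof (cases "Im z = 0")
      case True
      define x where "x = Re z"
      have zx: "z = complex_of_real x"
        using True by (simp add: x_def complex_eq_iff)
      have "poly_at p (complex_of_real x) = complex_of_real (poly p x)" for p
        by (induction p) (simp_all add: scaleR_conv_of_real)
      then have "poly q x = 0"
        using z by (simp add: zx)
      then obtain d where "q = [:- x, 1:] * d"
        by (auto simp: poly_eq_0_iff_dvd dvd_def)
      moreover have "x \<notin> real_spectrum a"
        using less.prems \<open>poly q x = 0\<close> by auto
      then have "invertible_elt (- (x *\<^sub>R 1 - a))"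
        by (simp only: real_spectrum_iff invertible_uminus_iff not_not)
      ultimately show ?thesis
        by (intro split[of "[:- x, 1:]"]) simp_all
    next
      case False
      define Q where "Q = [:(cmod z)\<^sup>2, - 2 * Re z, 1:]"
      have Q: "poly_at Q x = x * x - (2 * Re z) *\<^sub>R x + (cmod z)\<^sup>2 *\<^sub>R 1"
        for x :: "'b::unital_cstar_algebra"
        by (simp add: Q_def algebra_simps)
      have Qz: "poly_at Q z = 0"
        using cmod_power2[of z] unfolding Q by (simp add: complex_eq_iff power2_eq_square)
      have "degree (q mod Q) < 2"
        using degree_mod_less[of Q q] by (auto simp: Q_def split: if_splits)
      moreover obtain c0 d where cd: "q mod Q = pCons c0 d"
        by (cases "q mod Q")
      ultimately have "degree d = 0"
        by (auto split: if_splits)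
      with cd obtain c1 where r: "q mod Q = [:c0, c1:]"
        using degree_eq_zeroE by metis
      have "poly_at q z = poly_at (q div Q) z * poly_at Q z + poly_at (q mod Q) z"
        by (simp flip: poly_at_mult poly_at_add)
      then have "c0 *\<^sub>R 1 + z * (c1 *\<^sub>R 1) = 0"
        using z Qz by (simp add: r)
      then have "q mod Q = 0"
        using False by (auto simp: r complex_eq_iff)
      then have "q = Q * (q div Q)"
        using mult_div_mod_eq[of Q q] by simp
      moreover have "invertible_elt (poly_at Q a)"
        unfolding Q by (rule invertible_selfadjoint_minus_nonreal[OF sa False])
      ultimately show ?thesis
        by (intro split[of Q]) (simp_all add: Q_def)
    qed
  qed
qed

text \<open>
  The norm of \<open>p(a)\<close> is \<open>\<bar>y\<bar>\<close> for some \<open>y\<close> such that \<open>y - p(a)\<close> is not invertible; then \<open>y - p\<close> has a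
  root in the spectrum of \<open>a\<close>.
\<close>

lemma norm_poly_at_le:
  fixes a :: "'a::unital_cstar_algebra"
  assumes sa: "star a = a" and bound: "\<And>x. x \<in> real_spectrum a \<Longrightarrow> \<bar>poly p x\<bar> \<le> M"
  shows "norm (poly_at p a) \<le> M"
proof -
  obtain y where y: "y \<in> real_spectrum (poly_at p a)" "\<bar>y\<bar> = norm (poly_at p a)"
    using norm_in_real_spectrum star_poly_at[OF sa] by metis
  have "\<not> invertible_elt (poly_at ([:y:] - p) a)"
    using y(1) by (simp add: real_spectrum_iff poly_at_diff)
  then obtain x where "x \<in> real_spectrum a" "poly ([:y:] - p) x = 0"
    using invertible_poly_at[OF sa] by blast
  then show ?thesis
    using bound[of x] y by simp
qed

lemma poly_in_real_spectrum:
  assumes "x \<in> real_spectrum a"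
  shows "poly p x \<in> real_spectrum (poly_at p a)"
proof -
  have "poly ([:poly p x:] - p) x = 0"
    by simp
  then obtain d where d: "[:poly p x:] - p = [:- x, 1:] * d"
    unfolding poly_eq_0_iff_dvd dvd_def by blast
  have "poly p x *\<^sub>R 1 - poly_at p a = poly_at ([:poly p x:] - p) a"
    by (simp add: poly_at_diff)
  also have "\<dots> = poly_at [:- x, 1:] a * poly_at d a"
    by (simp only: d poly_at_mult)
  finally have eq: "poly p x *\<^sub>R 1 - poly_at p a = poly_at [:- x, 1:] a * poly_at d a" .
  have "\<not> invertible_elt (poly_at [:- x, 1:] a)"
    using assms invertible_uminus_iff[of "x *\<^sub>R 1 - a"] by (simp add: real_spectrum_iff)
  moreover have "poly_at [:- x, 1:] a * poly_at d a = poly_at d a * poly_at [:- x, 1:] a"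
    by (metis mult.commute poly_at_mult)
  ultimately show ?thesis
    unfolding real_spectrum_iff eq using invertible_factor by metis
qed

section \<open>The continuous functional calculus\<close>

lemma ex_polynomial_approximation:
  fixes f :: "real \<Rightarrow> real"
  assumes "compact K" "continuous_on K f"
  obtains p where "uniform_limit K (\<lambda>n. poly (p n)) f sequentially"
proof -
  have "\<exists>q. \<forall>x\<in>K. \<bar>f x - poly q x\<bar> < e" if e: "e > 0" for e
  proof -
    obtain g where g: "real_polynomial_function g" "\<And>x. x \<in> K \<Longrightarrow> \<bar>f x - g x\<bar> < e"
      using Stone_Weierstrass_real_polynomial_function[OF assms e] by metis
    then obtain c n where "g = (\<lambda>x. \<Sum>i\<le>n. c i * x ^ i)"
      by (auto simp: real_polynomial_function_iff_sum)
    then have "poly (\<Sum>i\<le>n. monom (c i) i) = g"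
      by (simp add: poly_sum poly_monom fun_eq_iff)
    with g show ?thesis
      by metis
  qed
  then have "\<forall>n. \<exists>q. \<forall>x\<in>K. \<bar>f x - poly q x\<bar> < inverse (real (Suc n))"
    by simp
  then obtain p where p: "\<And>n x. x \<in> K \<Longrightarrow> \<bar>f x - poly (p n) x\<bar> < inverse (real (Suc n))"
    by metis
  have "uniform_limit K (\<lambda>n. poly (p n)) f sequentially"
  proof (rule uniform_limitI)
    fix e :: real assume "e > 0"
    then obtain N where N: "inverse (real (Suc N)) < e"
      using reals_Archimedean by blast
    show "\<forall>\<^sub>F n in sequentially. \<forall>x\<in>K. dist (poly (p n) x) (f x) < e"
      using eventually_ge_at_top[of N]
    proof eventually_elim
      case (elim n)
      then have "inverse (real (Suc n)) \<le> inverse (real (Suc N))"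
        by (simp add: field_simps)
      then have "dist (poly (p n) x) (f x) < e" if "x \<in> K" for x
        using p[OF that, of n] N unfolding dist_real_def by argo
      then show ?case
        by blast
    qed
  qed
  then show ?thesis
    by (rule that)
qed

lemma poly_at_tendsto_cfc:
  fixes a :: "'a::unital_cstar_algebra"
  assumes sa: "star a = a" and cont: "continuous_on (real_spectrum a) f"
    and lim: "uniform_limit (real_spectrum a) (\<lambda>n. poly (p n)) f sequentially"
  shows "(\<lambda>n. poly_at (p n) a) \<longlonglongrightarrow> cfc f a"
proof -
  let ?K = "real_spectrum a"
  obtain p0 where p0: "uniform_limit ?K (\<lambda>n. poly (p0 n)) f sequentially"
    using ex_polynomial_approximation[OF compact_real_spectrum cont] .
  have "Cauchy (\<lambda>n. poly_at (p0 n) a)"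
  proof (rule metric_CauchyI)
    fix e :: real assume e: "e > 0"
    then have "\<forall>\<^sub>F n in sequentially. \<forall>x\<in>?K. dist (poly (p0 n) x) (f x) < e / 4"
      using uniform_limitD[OF p0, of "e / 4"] by simp
    then obtain N where N: "\<And>n x. n \<ge> N \<Longrightarrow> x \<in> ?K \<Longrightarrow> \<bar>poly (p0 n) x - f x\<bar> < e / 4"
      by (auto simp: eventually_sequentially dist_real_def)
    have "dist (poly_at (p0 m) a) (poly_at (p0 n) a) < e" if "m \<ge> N" "n \<ge> N" for m n
    proof -
      have "norm (poly_at (p0 m - p0 n) a) \<le> e / 2"
      proof (rule norm_poly_at_le[OF sa])
        fix x assume "x \<in> ?K"
        then show "\<bar>poly (p0 m - p0 n) x\<bar> \<le> e / 2"
          using N[OF that(1), of x] N[OF that(2), of x] unfolding poly_diff by argo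
      qed
      then show ?thesis
        using e by (simp add: dist_norm poly_at_diff)
    qed
    then show "\<exists>M. \<forall>m\<ge>M. \<forall>n\<ge>M. dist (poly_at (p0 m) a) (poly_at (p0 n) a) < e"
      by blast
  qed
  then obtain b where b: "(\<lambda>n. poly_at (p0 n) a) \<longlonglongrightarrow> b"
    using Cauchy_convergent_iff convergent_def by blast
  have all: "(\<lambda>n. poly_at (q n) a) \<longlonglongrightarrow> b"
    if q: "uniform_limit ?K (\<lambda>n. poly (q n)) f sequentially" for q
  proof -
    have "uniform_limit ?K (\<lambda>n x. poly (q n) x - poly (p0 n) x) (\<lambda>x. f x - f x) sequentially"
      by (intro uniform_limit_minus q p0)
    then have d: "uniform_limit ?K (\<lambda>n x. poly (q n - p0 n) x) (\<lambda>x. 0) sequentially"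
      by simp
    have "(\<lambda>n. poly_at (q n - p0 n) a) \<longlonglongrightarrow> 0"
    proof (rule tendstoI)
      fix e :: real assume "e > 0"
      then have "\<forall>\<^sub>F n in sequentially. \<forall>x\<in>?K. dist (poly (q n - p0 n) x) 0 < e / 2"
        using uniform_limitD[OF d, of "e / 2"] by simp
      then show "\<forall>\<^sub>F n in sequentially. dist (poly_at (q n - p0 n) a) 0 < e"
      proof eventually_elim
        case (elim n)
        then have "norm (poly_at (q n - p0 n) a) \<le> e / 2"
          by (intro norm_poly_at_le[OF sa]) (auto simp: dist_real_def less_imp_le)
        then show ?case
          using \<open>e > 0\<close> by simp
      qed
    qed
    from tendsto_add[OF this b] show ?thesis
      by (simp add: poly_at_diff)
  qed
  have "cfc f a = b"
    unfolding cfc_def real_spectrum_def[symmetric]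
    using all p0 LIMSEQ_unique by (intro the_equality) blast+
  then show ?thesis
    using all[OF lim] by simp
qed

text \<open>
  All properties of the calculus pass to the limit from polynomials; this is the form in which
  approximating polynomials are obtained.
\<close>

lemma cfc_approximation:
  fixes a :: "'a::unital_cstar_algebra"
  assumes "star a = a" "continuous_on (real_spectrum a) f"
  obtains p where "uniform_limit (real_spectrum a) (\<lambda>n. poly (p n)) f sequentially"
    "(\<lambda>n. poly_at (p n) a) \<longlonglongrightarrow> cfc f a"
  using ex_polynomial_approximation[OF compact_real_spectrum assms(2)] poly_at_tendsto_cfc[OF assms]
  by metis

lemma cfc_eqI:
  fixes a :: "'a::unital_cstar_algebra"
  assumes "star a = a" "continuous_on (real_spectrum a) f"
    and "uniform_limit (real_spectrum a) (\<lambda>n. poly (p n)) f sequentially"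
    and "(\<lambda>n. poly_at (p n) a) \<longlonglongrightarrow> b"
  shows "cfc f a = b"
  using poly_at_tendsto_cfc[OF assms(1-3)] assms(4) by (rule LIMSEQ_unique)

lemma cfc_cong:
  assumes "\<And>x. x \<in> real_spectrum a \<Longrightarrow> f x = g x"
  shows "cfc f a = cfc g a"
proof -
  have "uniform_limit (real_spectrum a) F f sequentially \<longleftrightarrow>
      uniform_limit (real_spectrum a) F g sequentially" for F
    using assms by (intro uniform_limit_cong') auto
  then show ?thesis
    by (simp add: cfc_def flip: real_spectrum_def)
qed

lemma cfc_poly:
  fixes a :: "'a::unital_cstar_algebra"
  assumes "star a = a"
  shows "cfc (poly p) a = poly_at p a"
  by (rule cfc_eqI[where p = "\<lambda>_. p"])
    (auto intro: assms continuous_intros simp: uniform_limit_iff)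

lemma cfc_const: "star a = a \<Longrightarrow> cfc (\<lambda>_. c) a = c *\<^sub>R 1"
  using cfc_poly[of a "[:c:]"] cfc_cong[of a "poly [:c:]" "\<lambda>_. c"] by simp

lemma cfc_id: "star a = a \<Longrightarrow> cfc (\<lambda>x. x) a = a"
  using cfc_poly[of a "[:0, 1:]"] cfc_cong[of a "poly [:0, 1:]" "\<lambda>x. x"] by simp

lemma cfc_diff:
  fixes a :: "'a::unital_cstar_algebra"
  assumes sa: "star a = a"
    and f: "continuous_on (real_spectrum a) f" and g: "continuous_on (real_spectrum a) g"
  shows "cfc (\<lambda>x. f x - g x) a = cfc f a - cfc g a"
proof -
  obtain p where p: "uniform_limit (real_spectrum a) (\<lambda>n. poly (p n)) f sequentially"
    "(\<lambda>n. poly_at (p n) a) \<longlonglongrightarrow> cfc f a"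
    using cfc_approximation[OF sa f] .
  obtain q where q: "uniform_limit (real_spectrum a) (\<lambda>n. poly (q n)) g sequentially"
    "(\<lambda>n. poly_at (q n) a) \<longlonglongrightarrow> cfc g a"
    using cfc_approximation[OF sa g] .
  show ?thesis
  proof (rule cfc_eqI[OF sa])
    show "uniform_limit (real_spectrum a) (\<lambda>n. poly (p n - q n)) (\<lambda>x. f x - g x) sequentially"
      unfolding poly_diff[abs_def] by (rule uniform_limit_minus[OF p(1) q(1)])
    show "(\<lambda>n. poly_at (p n - q n) a) \<longlonglongrightarrow> cfc f a - cfc g a"
      unfolding poly_at_diff by (intro tendsto_diff p q)
  qed (intro continuous_intros f g)
qed

lemma cfc_mult:
  fixes a :: "'a::unital_cstar_algebra"
  assumes sa: "star a = a"
    and f: "continuous_on (real_spectrum a) f" and g: "continuous_on (real_spectrum a) g"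
  shows "cfc (\<lambda>x. f x * g x) a = cfc f a * cfc g a"
proof -
  obtain p where p: "uniform_limit (real_spectrum a) (\<lambda>n. poly (p n)) f sequentially"
    "(\<lambda>n. poly_at (p n) a) \<longlonglongrightarrow> cfc f a"
    using cfc_approximation[OF sa f] .
  obtain q where q: "uniform_limit (real_spectrum a) (\<lambda>n. poly (q n)) g sequentially"
    "(\<lambda>n. poly_at (q n) a) \<longlonglongrightarrow> cfc g a"
    using cfc_approximation[OF sa g] .
  show ?thesis
  proof (rule cfc_eqI[OF sa])
    have "bounded (f ` real_spectrum a)" "bounded (g ` real_spectrum a)"
      using f g compact_real_spectrum by (auto intro: compact_imp_bounded compact_continuous_image)
    from uniform_lim_mult[OF p(1) q(1) this]
    show "uniform_limit (real_spectrum a) (\<lambda>n. poly (p n * q n)) (\<lambda>x. f x * g x) sequentially"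
      unfolding poly_mult[abs_def] .
    show "(\<lambda>n. poly_at (p n * q n) a) \<longlonglongrightarrow> cfc f a * cfc g a"
      unfolding poly_at_mult by (intro tendsto_mult p q)
  qed (intro continuous_intros f g)
qed

lemma star_cfc:
  fixes a :: "'a::unital_cstar_algebra"
  assumes sa: "star a = a" and f: "continuous_on (real_spectrum a) f"
  shows "star (cfc f a) = cfc f a"
proof -
  obtain p where p: "(\<lambda>n. poly_at (p n) a) \<longlonglongrightarrow> cfc f a"
    using cfc_approximation[OF assms] by metis
  from tendsto_star[OF p] have "(\<lambda>n. poly_at (p n) a) \<longlonglongrightarrow> star (cfc f a)"
    by (simp add: star_poly_at sa)
  with p show ?thesis
    by (rule LIMSEQ_unique[symmetric])
qed

lemma cfc_commute:
  fixes a :: "'a::unital_cstar_algebra"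
  assumes "star a = a" "continuous_on (real_spectrum a) f" and x: "x * a = a * x"
  shows "x * cfc f a = cfc f a * x"
proof -
  obtain p where p: "(\<lambda>n. poly_at (p n) a) \<longlonglongrightarrow> cfc f a"
    using cfc_approximation[OF assms(1,2)] by metis
  have "(\<lambda>n. x * poly_at (p n) a) \<longlonglongrightarrow> x * cfc f a" "(\<lambda>n. poly_at (p n) a * x) \<longlonglongrightarrow> cfc f a * x"
    by (intro tendsto_intros p)+
  then show ?thesis
    using LIMSEQ_unique by (simp add: poly_at_commute[OF x])
qed

lemma norm_cfc_le:
  fixes a :: "'a::unital_cstar_algebra"
  assumes sa: "star a = a" and f: "continuous_on (real_spectrum a) f"
    and bound: "\<And>x. x \<in> real_spectrum a \<Longrightarrow> \<bar>f x\<bar> \<le> M"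
  shows "norm (cfc f a) \<le> M"
proof (rule field_le_epsilon)
  fix e :: real assume "e > 0"
  obtain p where p: "uniform_limit (real_spectrum a) (\<lambda>n. poly (p n)) f sequentially"
    "(\<lambda>n. poly_at (p n) a) \<longlonglongrightarrow> cfc f a"
    using cfc_approximation[OF sa f] .
  have "\<forall>\<^sub>F n in sequentially. \<forall>x\<in>real_spectrum a. dist (poly (p n) x) (f x) < e"
    using p(1) \<open>e > 0\<close> by (auto simp: uniform_limit_iff)
  then have "\<forall>\<^sub>F n in sequentially. norm (poly_at (p n) a) \<le> M + e"
  proof eventually_elim
    case (elim n)
    then show ?case
      using bound by (intro norm_poly_at_le[OF sa]) (force simp: dist_real_def)
  qed
  then show "norm (cfc f a) \<le> M + e"
    using tendsto_upperbound[OF tendsto_norm[OF p(2)]] by simp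
qed

text \<open>
  If \<open>y\<close> is not a value of \<open>f\<close> on the spectrum, then \<open>1 / (y - f)\<close> is continuous there and provides an
  inverse of \<open>y - f(a)\<close>. Conversely, \<open>f(x) - f(a)\<close> is a limit of the elements \<open>p\<^sub>n(x) - p\<^sub>n(a)\<close>,
  which are not invertible as they have the factor \<open>x - a\<close>.
\<close>

lemma real_spectrum_cfc:
  fixes a :: "'a::unital_cstar_algebra"
  assumes sa: "star a = a" and f: "continuous_on (real_spectrum a) f"
  shows "real_spectrum (cfc f a) = f ` real_spectrum a"
proof
  show "f ` real_spectrum a \<subseteq> real_spectrum (cfc f a)"
  proof
    fix y assume "y \<in> f ` real_spectrum a"
    then obtain x where x: "x \<in> real_spectrum a" "y = f x"
      by blast
    obtain p where p: "uniform_limit (real_spectrum a) (\<lambda>n. poly (p n)) f sequentially"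
      "(\<lambda>n. poly_at (p n) a) \<longlonglongrightarrow> cfc f a"
      using cfc_approximation[OF sa f] .
    have "(\<lambda>n. poly (p n) x) \<longlonglongrightarrow> f x"
      using tendsto_uniform_limitI[OF p(1) x(1)] .
    then have "(\<lambda>n. poly (p n) x *\<^sub>R 1 - poly_at (p n) a) \<longlonglongrightarrow> f x *\<^sub>R 1 - cfc f a"
      by (intro tendsto_intros p)
    from noninvertible_limit[OF this] show "y \<in> real_spectrum (cfc f a)"
      using poly_in_real_spectrum[OF x(1)] x(2) by (simp add: real_spectrum_iff)
  qed
  show "real_spectrum (cfc f a) \<subseteq> f ` real_spectrum a"
  proof (rule subsetI, rule ccontr)
    fix y assume y: "y \<in> real_spectrum (cfc f a)" "y \<notin> f ` real_spectrum a"
    then have ne: "y - f x \<noteq> 0" if "x \<in> real_spectrum a" for x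
      using that by auto
    let ?g = "\<lambda>x. y - f x" and ?h = "\<lambda>x. inverse (y - f x)"
    have cont: "continuous_on (real_spectrum a) ?g" "continuous_on (real_spectrum a) ?h"
      using ne by (auto intro!: continuous_intros f)
    have "cfc ?g a = y *\<^sub>R 1 - cfc f a"
      using cfc_diff[OF sa continuous_on_const f, of y] by (simp add: cfc_const sa)
    moreover have "cfc (\<lambda>x. ?g x * ?h x) a = cfc (\<lambda>_. 1) a" "cfc (\<lambda>x. ?h x * ?g x) a = cfc (\<lambda>_. 1) a"
      using ne by (auto intro!: cfc_cong)
    then have "cfc ?g a * cfc ?h a = 1" "cfc ?h a * cfc ?g a = 1"
      using cont by (simp_all add: cfc_mult[symmetric] cfc_const sa)
    then have "invertible_elt (cfc ?g a)"
      by (rule inv_eltI)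
    ultimately show False
      using y(1) by (simp add: real_spectrum_iff)
  qed
qed

lemma cfc_compose:
  fixes a :: "'a::unital_cstar_algebra"
  assumes sa: "star a = a" and f: "continuous_on (real_spectrum a) f"
    and g: "continuous_on (f ` real_spectrum a) g"
  shows "cfc g (cfc f a) = cfc (\<lambda>x. g (f x)) a"
proof -
  let ?b = "cfc f a"
  have sb: "star ?b = ?b"
    by (rule star_cfc[OF sa f])
  have Kb: "real_spectrum ?b = f ` real_spectrum a"
    by (rule real_spectrum_cfc[OF sa f])
  have cont: "continuous_on (real_spectrum a) (\<lambda>x. h (f x))" if "continuous_on (f ` real_spectrum a) h" for h
    using continuous_on_compose[OF f that] by (simp add: comp_def)
  have poly: "poly_at q ?b = cfc (\<lambda>x. poly q (f x)) a" for q
  proof (induction q)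
    case 0
    show ?case
      using cfc_const[OF sa, of 0] by simp
  next
    case (pCons c q)
    have cq: "continuous_on (real_spectrum a) (\<lambda>x. poly q (f x))"
      by (intro cont continuous_intros)
    have "cfc (\<lambda>x. c - (- f x * poly q (f x))) a = c *\<^sub>R 1 - cfc (\<lambda>x. - f x * poly q (f x)) a"
      by (subst cfc_diff[OF sa]) (auto intro!: continuous_intros f cq simp: cfc_const sa)
    also have "cfc (\<lambda>x. - f x * poly q (f x)) a = cfc (\<lambda>x. - f x) a * cfc (\<lambda>x. poly q (f x)) a"
      by (intro cfc_mult sa continuous_intros f cq)
    also have "cfc (\<lambda>x. - f x) a = - ?b"
      using cfc_diff[OF sa continuous_on_const f, of 0] by (simp add: cfc_const sa)
    finally show ?case
      by (simp add: pCons.IH)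
  qed
  have "continuous_on (real_spectrum ?b) g"
    using g by (simp only: Kb)
  from cfc_approximation[OF sb this]
  obtain q where q: "uniform_limit (real_spectrum ?b) (\<lambda>n. poly (q n)) g sequentially"
    "(\<lambda>n. poly_at (q n) ?b) \<longlonglongrightarrow> cfc g ?b" .
  have "(\<lambda>n. poly_at (q n) ?b) \<longlonglongrightarrow> cfc (\<lambda>x. g (f x)) a"
  proof (rule tendstoI)
    fix e :: real assume "e > 0"
    then have "\<forall>\<^sub>F n in sequentially. \<forall>y\<in>real_spectrum ?b. dist (poly (q n) y) (g y) < e / 2"
      using uniform_limitD[OF q(1), of "e / 2"] by simp
    then show "\<forall>\<^sub>F n in sequentially. dist (poly_at (q n) ?b) (cfc (\<lambda>x. g (f x)) a) < e"
    proof eventually_elim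
      case (elim n)
      have c: "continuous_on (real_spectrum a) (\<lambda>x. poly (q n) (f x))"
        "continuous_on (real_spectrum a) (\<lambda>x. g (f x))"
        by (intro cont continuous_intros g)+
      have "norm (cfc (\<lambda>x. poly (q n) (f x) - g (f x)) a) \<le> e / 2"
        using elim by (intro norm_cfc_le[OF sa] continuous_on_diff c)
          (auto simp: Kb dist_real_def less_imp_le)
      then show ?case
        using \<open>e > 0\<close> by (simp add: dist_norm poly cfc_diff[OF sa c])
    qed
  qed
  then show ?thesis
    using q(2) LIMSEQ_unique by blast
qed

section \<open>Positivity\<close>

lemma real_spectrum_add_scalar:
  "x \<in> real_spectrum (t *\<^sub>R 1 - a) \<longleftrightarrow> t - x \<in> real_spectrum a"
proof -
  have "x *\<^sub>R 1 - (t *\<^sub>R 1 - a) = - ((t - x) *\<^sub>R 1 - a)"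
    by (simp add: algebra_simps)
  then show ?thesis
    by (simp only: real_spectrum_iff invertible_uminus_iff)
qed

text \<open>
  For self-adjoint \<open>a\<close>, positivity is equivalent to \<open>norm (\<tau> - a) \<le> \<tau>\<close> for some \<open>\<tau>\<close>, and in this form
  it is stable under sums by the triangle inequality.
\<close>

lemma real_spectrum_nonneg_if_norm_le:
  assumes "norm (\<tau> *\<^sub>R 1 - a) \<le> \<tau>"
  shows "real_spectrum a \<subseteq> {0..}"
proof
  fix x assume "x \<in> real_spectrum a"
  then have "\<tau> - x \<in> real_spectrum (\<tau> *\<^sub>R 1 - a)"
    by (simp add: real_spectrum_add_scalar)
  then show "x \<in> {0..}"
    using abs_le_norm_if_in_real_spectrum[of "\<tau> - x"] assms by fastforce
qed

lemma norm_le_if_real_spectrum_nonneg: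
  fixes a :: "'a::unital_cstar_algebra"
  assumes "star a = a" "real_spectrum a \<subseteq> {0..}"
  shows "norm (norm a *\<^sub>R 1 - a) \<le> norm a"
proof -
  have "norm (poly_at [:norm a, -1:] a) \<le> norm a"
    using assms abs_le_norm_if_in_real_spectrum[of _ a]
    by (intro norm_poly_at_le) (fastforce simp: abs_le_iff)+
  then show ?thesis
    by simp
qed

lemma real_spectrum_nonneg_add:
  fixes a b :: "'a::unital_cstar_algebra"
  assumes "star a = a" "real_spectrum a \<subseteq> {0..}" "star b = b" "real_spectrum b \<subseteq> {0..}"
  shows "real_spectrum (a + b) \<subseteq> {0..}"
proof (rule real_spectrum_nonneg_if_norm_le)
  have "(norm a + norm b) *\<^sub>R 1 - (a + b) = (norm a *\<^sub>R 1 - a) + (norm b *\<^sub>R 1 - b)"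
    by (simp add: algebra_simps)
  also have "norm \<dots> \<le> norm a + norm b"
    using norm_le_if_real_spectrum_nonneg assms by (intro norm_triangle_mono)
  finally show "norm ((norm a + norm b) *\<^sub>R 1 - (a + b)) \<le> norm a + norm b" .
qed

lemma real_spectrum_square:
  fixes b :: "'a::unital_cstar_algebra"
  assumes "star b = b"
  shows "real_spectrum (b * b) \<subseteq> {0..}"
  by (rule real_spectrum_nonneg_if_norm_le) (rule norm_scalar_minus_square[OF assms order_refl])

text \<open>If \<open>u\<close> inverts \<open>\<lambda> - xy\<close>, then \<open>(1 + yux) / \<lambda>\<close> inverts \<open>\<lambda> - yx\<close>.\<close>

lemma real_spectrum_mult_commute:
  assumes "t \<in> real_spectrum (y * x)" "t \<noteq> 0"
  shows "t \<in> real_spectrum (x * y)"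
proof (rule ccontr)
  assume "t \<notin> real_spectrum (x * y)"
  then have inv: "invertible_elt (t *\<^sub>R 1 - x * y)"
    by (simp add: real_spectrum_iff)
  define u where "u = inv_elt (t *\<^sub>R 1 - x * y)"
  have "(t *\<^sub>R 1 - x * y) * u = 1" "u * (t *\<^sub>R 1 - x * y) = 1"
    using inv by (simp_all add: u_def)
  then have u: "x * (y * u) = t *\<^sub>R u - 1" "u * (x * y) = t *\<^sub>R u - 1"
    by (simp_all add: algebra_simps)
  have "(t *\<^sub>R 1 - y * x) * (1 + y * u * x) = t *\<^sub>R 1 + t *\<^sub>R (y * u * x) - y * x - y * (x * (y * u)) * x"
    by (simp add: algebra_simps)
  also have "\<dots> = t *\<^sub>R 1"
    unfolding u by (simp add: algebra_simps)
  finally have 1: "(t *\<^sub>R 1 - y * x) * (1 + y * u * x) = t *\<^sub>R 1" .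
  have "(1 + y * u * x) * (t *\<^sub>R 1 - y * x) = t *\<^sub>R 1 + t *\<^sub>R (y * u * x) - y * x - y * (u * (x * y)) * x"
    by (simp add: algebra_simps)
  also have "\<dots> = t *\<^sub>R 1"
    unfolding u by (simp add: algebra_simps)
  finally have 2: "(1 + y * u * x) * (t *\<^sub>R 1 - y * x) = t *\<^sub>R 1" .
  have "invertible_elt (t *\<^sub>R 1 - y * x)"
    using 1 2 assms(2) by (intro inv_eltI(1)[of _ "inverse t *\<^sub>R (1 + y * u * x)"]) simp_all
  with assms(1) show False
    by (simp add: real_spectrum_iff)
qed

text \<open>
  The classical argument: \<open>c\<^sup>*c + cc\<^sup>*\<close> is twice the sum of the squares of the real and imaginary
  parts of \<open>c\<close>. So if \<open>cc\<^sup>* \<le> 0\<close>, then \<open>c\<^sup>*c \<ge> 0\<close>; as both have the same nonzero spectrum, it is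
  empty.
\<close>

lemma eq_zero_if_mult_star_nonpos:
  fixes c :: "'a::unital_cstar_algebra"
  assumes nonpos: "real_spectrum (c * star c) \<subseteq> {..0}"
  shows "c = 0"
proof -
  define h where "h = c + star c"
  define k where "k = \<i> *\<^sub>C (c - star c)"
  have ii: "\<i> *\<^sub>C \<i> *\<^sub>C x = - x" "(- \<i>) *\<^sub>C x = - (\<i> *\<^sub>C x)" for x :: 'a
    using scaleC_of_real[of "-1" x] scaleC_add_left[of \<i> "- \<i>" x] scaleC_of_real[of 0 x]
    by (simp_all add: scaleC_scaleC add_eq_0_iff)
  have h: "star h = h" and k: "star k = k"
    by (simp_all add: h_def k_def star_add star_star star_diff star_scaleC add.commute ii scaleC_diff_right)
  have "k * k = - ((c - star c) * (c - star c))"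
    by (simp add: k_def mult_scaleC_left mult_scaleC_right ii)
  then have "h * h + k * k = 2 *\<^sub>R (star c * c + c * star c)"
    by (simp add: h_def algebra_simps scaleR_2)
  then have eq: "2 *\<^sub>R (star c * c) = (h * h + k * k) + 2 *\<^sub>R (- (c * star c))"
    by (simp add: scaleR_add_right)
  have scale: "real_spectrum (2 *\<^sub>R x) \<subseteq> {0..} \<longleftrightarrow> real_spectrum x \<subseteq> {0..}" for x :: 'a
  proof -
    have *: "t *\<^sub>R 1 - 2 *\<^sub>R x = 2 *\<^sub>R ((t / 2) *\<^sub>R 1 - x)" for t
      by (simp add: algebra_simps)
    have "t \<in> real_spectrum (2 *\<^sub>R x) \<longleftrightarrow> t / 2 \<in> real_spectrum x" for t
      by (simp add: real_spectrum_iff * invertible_scaleR_iff)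
    then have "y \<in> real_spectrum x \<longleftrightarrow> 2 * y \<in> real_spectrum (2 *\<^sub>R x)"
      "y \<in> real_spectrum (2 *\<^sub>R x) \<longleftrightarrow> y / 2 \<in> real_spectrum x" for y
      by simp_all
    then show ?thesis
      unfolding subset_iff by (metis atLeast_iff zero_le_divide_iff zero_le_mult_iff zero_le_numeral
          not_numeral_le_zero)
  qed
  have "real_spectrum (2 *\<^sub>R (- (c * star c))) \<subseteq> {0..}"
    unfolding scale using nonpos real_spectrum_add_scalar[of _ 0 "c * star c"] by fastforce
  then have "real_spectrum ((h * h + k * k) + 2 *\<^sub>R (- (c * star c))) \<subseteq> {0..}"
    using h k by (intro real_spectrum_nonneg_add real_spectrum_square)
      (simp_all add: star_add star_mult star_star)
  then have nonneg: "real_spectrum (star c * c) \<subseteq> {0..}"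
    by (simp only: scale flip: eq)
  obtain t where t: "t \<in> real_spectrum (c * star c)" "\<bar>t\<bar> = norm (c * star c)"
    using norm_in_real_spectrum[of "c * star c"] by (auto simp: star_mult star_star)
  have "t = 0"
    using real_spectrum_mult_commute[OF t(1)] t(1) nonpos nonneg by force
  then show ?thesis
    using t(2) by (simp add: cstar_identity')
qed

lemma pos_inv_iff:
  "a \<in> pos_inv \<longleftrightarrow> star a = a \<and> real_spectrum a \<subseteq> {0<..}"
proof -
  have "invertible_elt a \<longleftrightarrow> 0 \<notin> real_spectrum a"
    by (simp add: real_spectrum_iff invertible_uminus_iff)
  moreover have "spectrum a \<subseteq> complex_of_real ` {0..} \<longleftrightarrow> real_spectrum a \<subseteq> {0..}" if "star a = a"
    unfolding spectrum_selfadjoint[OF that] by (auto simp: image_subset_iff)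
  moreover have "S \<subseteq> {0..} \<and> 0 \<notin> S \<longleftrightarrow> S \<subseteq> {0<..}" for S :: "real set"
    by (auto simp: less_le)
  ultimately show ?thesis
    unfolding pos_inv_def mem_Collect_eq by metis
qed

lemma pos_inv_selfadjoint: "a \<in> pos_inv \<Longrightarrow> star a = a"
  by (simp add: pos_inv_def)

lemma pos_inv_invertible: "a \<in> pos_inv \<Longrightarrow> invertible_elt a"
  by (simp add: pos_inv_def)

text \<open>With \<open>n\<close> the negative part of \<open>y = xx\<^sup>*\<close>, the element \<open>(nx)(nx)\<^sup>* = nyn\<close> is negative.\<close>

lemma mult_star_pos_inv:
  fixes x :: "'a::unital_cstar_algebra"
  assumes x: "invertible_elt x"
  shows "x * star x \<in> pos_inv"
proof -
  define y where "y = x * star x"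
  have sy: "star y = y"
    by (simp add: y_def star_mult star_star)
  define f where "f t = max (- t) 0" for t :: real
  have cont: "continuous_on S f" for S
    unfolding f_def by (intro continuous_intros)
  define n where "n = cfc f y"
  have sn: "star n = n"
    unfolding n_def by (rule star_cfc[OF sy cont])
  have "(n * x) * star (n * x) = n * y * n"
    by (simp add: y_def star_mult sn mult.assoc)
  also have "\<dots> = cfc (\<lambda>t. f t * t * f t) y"
    unfolding n_def by (simp add: cfc_mult sy cont cfc_id continuous_intros)
  finally have eq: "(n * x) * star (n * x) = cfc (\<lambda>t. f t * t * f t) y" .
  have "real_spectrum ((n * x) * star (n * x)) = (\<lambda>t. f t * t * f t) ` real_spectrum y"
    unfolding eq by (intro real_spectrum_cfc sy continuous_intros cont)
  also have "\<dots> \<subseteq> {..0}"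
    by (auto simp: f_def max_def mult_le_0_iff zero_le_mult_iff)
  finally have "n * x = 0"
    by (rule eq_zero_if_mult_star_nonpos)
  then have "n * (x * inv_elt x) = 0"
    by (simp flip: mult.assoc)
  then have "n = 0"
    using x by simp
  have "t \<ge> 0" if "t \<in> real_spectrum y" for t
  proof -
    have "f t \<in> real_spectrum n"
      unfolding n_def using that by (simp add: real_spectrum_cfc sy cont)
    then have "\<bar>f t\<bar> \<le> 0"
      using abs_le_norm_if_in_real_spectrum[of "f t" n] \<open>n = 0\<close> by simp
    then show ?thesis
      by (simp add: f_def)
  qed
  moreover have "0 \<notin> real_spectrum y"
    using x by (simp add: real_spectrum_iff invertible_uminus_iff y_def invertible_mult star_inverse)
  ultimately have "real_spectrum y \<subseteq> {0<..}"
    by (force simp: less_le)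
  then show ?thesis
    using sy by (simp add: pos_inv_iff y_def)
qed

lemma one_pos_inv: "(1::'a::unital_cstar_algebra) \<in> pos_inv"
  using mult_star_pos_inv[of "1::'a"] inv_eltI(1)[of "1::'a" 1] by simp

section \<open>Real powers\<close>

lemma continuous_powr_spectrum:
  "a \<in> pos_inv \<Longrightarrow> continuous_on (real_spectrum a) (\<lambda>x. x powr t)"
  by (intro continuous_intros) (auto simp: pos_inv_iff)

lemma pow_elt_add:
  assumes "a \<in> pos_inv"
  shows "pow_elt a (s + t) = pow_elt a s * pow_elt a t"
  unfolding pow_elt_def powr_add using assms
  by (intro cfc_mult continuous_powr_spectrum pos_inv_selfadjoint)

lemma pow_elt_0:
  assumes "a \<in> pos_inv"
  shows "pow_elt a 0 = 1"
proof -
  have "cfc (\<lambda>x. x powr 0) a = cfc (\<lambda>_. 1) a"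
    using assms by (intro cfc_cong) (auto simp: pos_inv_iff)
  then show ?thesis
    using assms by (simp add: pow_elt_def cfc_const pos_inv_selfadjoint)
qed

lemma pow_elt_1:
  assumes "a \<in> pos_inv"
  shows "pow_elt a 1 = a"
proof -
  have "cfc (\<lambda>x. x powr 1) a = cfc (\<lambda>x. x) a"
    using assms by (intro cfc_cong) (auto simp: pos_inv_iff)
  then show ?thesis
    using assms by (simp add: pow_elt_def cfc_id pos_inv_selfadjoint)
qed

lemma real_spectrum_pow_elt:
  assumes "a \<in> pos_inv"
  shows "real_spectrum (pow_elt a t) = (\<lambda>x. x powr t) ` real_spectrum a"
  unfolding pow_elt_def using assms
  by (intro real_spectrum_cfc continuous_powr_spectrum pos_inv_selfadjoint)

lemma star_pow_elt: "a \<in> pos_inv \<Longrightarrow> star (pow_elt a t) = pow_elt a t"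
  unfolding pow_elt_def by (intro star_cfc continuous_powr_spectrum pos_inv_selfadjoint)

lemma pow_elt_pos_inv: "a \<in> pos_inv \<Longrightarrow> pow_elt a t \<in> pos_inv"
  using star_pow_elt[of a t] real_spectrum_pow_elt[of a t] by (auto simp: pos_inv_iff)

lemma pow_elt_pow_elt:
  assumes "a \<in> pos_inv"
  shows "pow_elt (pow_elt a s) t = pow_elt a (s * t)"
proof -
  have "cfc (\<lambda>x. x powr t) (cfc (\<lambda>x. x powr s) a) = cfc (\<lambda>x. (x powr s) powr t) a"
    using assms
    by (intro cfc_compose continuous_powr_spectrum pos_inv_selfadjoint continuous_intros)
      (auto simp: pos_inv_iff)
  then show ?thesis
    by (simp add: pow_elt_def powr_powr)
qed

lemma pow_elt_commute: "a \<in> pos_inv \<Longrightarrow> x * a = a * x \<Longrightarrow> x * pow_elt a t = pow_elt a t * x"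
  unfolding pow_elt_def by (intro cfc_commute continuous_powr_spectrum pos_inv_selfadjoint)

lemma pow_elt_inverse:
  assumes "a \<in> pos_inv"
  shows "pow_elt a t * pow_elt a (- t) = 1" "pow_elt a (- t) * pow_elt a t = 1"
  using pow_elt_add[OF assms, of t "- t"] pow_elt_add[OF assms, of "- t" t] pow_elt_0[OF assms]
  by simp_all

lemma inv_pow_elt:
  assumes "a \<in> pos_inv"
  shows "invertible_elt (pow_elt a t)" "inv_elt (pow_elt a t) = pow_elt a (- t)"
  using inv_eltI[OF pow_elt_inverse[OF assms]] by simp_all

lemma pow_elt_half_mult_half: "a \<in> pos_inv \<Longrightarrow> pow_elt a (t / 2) * pow_elt a (t / 2) = pow_elt a t"
  by (simp flip: pow_elt_add)

lemma pow_elt_square: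
  assumes "a \<in> pos_inv"
  shows "a\<^sup>2 \<in> pos_inv" "pow_elt (a\<^sup>2) t = pow_elt a (2 * t)"
proof -
  have "a\<^sup>2 = pow_elt a 2"
    using pow_elt_add[OF assms, of 1 1] pow_elt_1[OF assms] by (simp add: power2_eq_square)
  then show "a\<^sup>2 \<in> pos_inv" "pow_elt (a\<^sup>2) t = pow_elt a (2 * t)"
    using assms by (simp_all add: pow_elt_pos_inv pow_elt_pow_elt)
qed

lemma pow_elt_one: "pow_elt (1::'a::unital_cstar_algebra) t = 1"
proof -
  have "pow_elt (pow_elt (1::'a) 0) t = pow_elt 1 (0 * t)"
    by (rule pow_elt_pow_elt[OF one_pos_inv])
  then show ?thesis
    by (simp add: pow_elt_0[OF one_pos_inv])
qed

lemma norm_pow_elt_le: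
  fixes a :: "'a::unital_cstar_algebra"
  assumes a: "a \<in> pos_inv" and t: "0 \<le> t" "t \<le> 1"
  shows "norm (pow_elt a t) \<le> 1 + norm a"
  unfolding pow_elt_def
proof (rule norm_cfc_le)
  fix x assume x: "x \<in> real_spectrum a"
  then have x: "0 < x" "x \<le> norm a"
    using a abs_le_norm_if_in_real_spectrum[OF x] by (auto simp: pos_inv_iff)
  have "x powr t \<le> (1 + norm a) powr t"
    using x t by (intro powr_mono2) auto
  also have "\<dots> \<le> (1 + norm a) powr 1"
    using t by (intro powr_mono) auto
  also have "\<dots> = 1 + norm a"
    by (simp add: add_nonneg_eq_0_iff)
  finally show "\<bar>x powr t\<bar> \<le> 1 + norm a"
    by simp
qed (use a in \<open>auto intro: continuous_powr_spectrum pos_inv_selfadjoint\<close>)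

section \<open>Log-convexity of the norm\<close>

text \<open>The norm of a self-adjoint product is a spectral value, also of the reversed product.\<close>

lemma norm_selfadjoint_mult_le:
  fixes u v :: "'a::unital_cstar_algebra"
  assumes "star (u * v) = u * v"
  shows "norm (u * v) \<le> norm (v * u)"
proof -
  obtain x where x: "x \<in> real_spectrum (u * v)" "\<bar>x\<bar> = norm (u * v)"
    using norm_in_real_spectrum[OF assms] by blast
  show ?thesis
  proof (cases "x = 0")
    case False
    from abs_le_norm_if_in_real_spectrum[OF real_spectrum_mult_commute[OF x(1) this]]
    show ?thesis
      using x(2) by simp
  qed (use x in auto)
qed

text \<open>
  For \<open>T = x\<^sup>m g y\<^sup>m\<close> with \<open>m = (s + t) / 2\<close>, the element \<open>T\<^sup>*T\<close> is the conjugate by \<open>y\<^sup>m\<^sup>-\<^sup>s\<close> of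
  \<open>(y\<^sup>s g\<^sup>* x\<^sup>s)(x\<^sup>t g y\<^sup>t)\<close>; being self-adjoint, its norm does not exceed that of this product.
\<close>

lemma norm_pow_elt_midpoint:
  fixes g :: "'a::unital_cstar_algebra"
  assumes x: "x \<in> pos_inv" and y: "y \<in> pos_inv"
  shows "(norm (pow_elt x ((s + t) / 2) * g * pow_elt y ((s + t) / 2)))\<^sup>2
    \<le> norm (pow_elt x s * g * pow_elt y s) * norm (pow_elt x t * g * pow_elt y t)"
proof -
  define m where "m = (s + t) / 2"
  define T where "T r = pow_elt x r * g * pow_elt y r" for r
  have star_T: "star (T r) = pow_elt y r * star g * pow_elt x r" for r
    by (simp add: T_def star_mult star_pow_elt x y mult.assoc)
  have xm: "pow_elt x m * pow_elt x m = pow_elt x s * pow_elt x t"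
    by (simp add: m_def flip: pow_elt_add[OF x])
  have ym: "pow_elt y m = pow_elt y (m - s) * pow_elt y s" "pow_elt y m = pow_elt y t * pow_elt y (s - m)"
    by (simp_all add: m_def field_simps flip: pow_elt_add[OF y])
  have inv: "pow_elt y (s - m) * pow_elt y (m - s) = 1"
    by (simp add: pow_elt_0[OF y] flip: pow_elt_add[OF y])
  have "star (T m) * T m = pow_elt y m * star g * (pow_elt x m * pow_elt x m) * g * pow_elt y m"
    unfolding star_T unfolding T_def by (simp only: mult.assoc)
  also have "\<dots> = (pow_elt y (m - s) * pow_elt y s) * star g * (pow_elt x s * pow_elt x t) * g
      * (pow_elt y t * pow_elt y (s - m))"
    by (simp only: xm ym(1)[symmetric] ym(2)[symmetric])
  also have "\<dots> = pow_elt y (m - s) * (star (T s) * T t * pow_elt y (s - m))"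
    unfolding star_T unfolding T_def by (simp only: mult.assoc)
  finally have eq: "star (T m) * T m = pow_elt y (m - s) * (star (T s) * T t * pow_elt y (s - m))" .
  have "(norm (T m))\<^sup>2 = norm (star (T m) * T m)"
    by (simp add: cstar_identity)
  also have "\<dots> \<le> norm ((star (T s) * T t * pow_elt y (s - m)) * pow_elt y (m - s))"
    unfolding eq by (rule norm_selfadjoint_mult_le) (simp add: star_mult star_star flip: eq)
  also have "\<dots> = norm (star (T s) * T t)"
    by (simp add: mult.assoc inv)
  also have "\<dots> \<le> norm (T s) * norm (T t)"
    using norm_mult_ineq[of "star (T s)" "T t"] by simp
  finally show ?thesis
    by (simp add: T_def m_def)
qed

text \<open>
  Dividing by the log-affine function with the same values at the ends of the interval gives a
  function \<open>\<phi>\<close> with \<open>\<phi> 0 = \<phi> 1 = 1\<close>. Each point is the midpoint of one of the ends and another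
  point, so that the supremum \<open>S\<close> of \<open>\<phi>\<close> satisfies \<open>S\<^sup>2 \<le> S\<close>.
\<close>

lemma log_convex_if_midpoint_log_convex:
  fixes N :: "real \<Rightarrow> real"
  assumes mid: "\<And>s t. \<lbrakk>s \<in> {0..1}; t \<in> {0..1}\<rbrakk> \<Longrightarrow> (N ((s + t) / 2))\<^sup>2 \<le> N s * N t"
    and bound: "\<And>t. t \<in> {0..1} \<Longrightarrow> N t \<le> C"
    and nonneg: "\<And>t. N t \<ge> 0" and pos: "N 0 > 0" "N 1 > 0" and t: "t \<in> {0..1}"
  shows "N t \<le> N 0 powr (1 - t) * N 1 powr t"
proof -
  define w where "w t = N 0 powr (t - 1) * N 1 powr (- t)" for t
  define \<phi> where "\<phi> t = N t * w t" for t
  have w_pos: "w t > 0" for t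
    using pos by (simp add: w_def)
  have w_mid: "(w ((s + t) / 2))\<^sup>2 = w s * w t" for s t
  proof -
    have halves: "((s + t) / 2 - 1) + ((s + t) / 2 - 1) = (s - 1) + (t - 1)"
      "- ((s + t) / 2) + - ((s + t) / 2) = - s + - t"
      by (simp_all add: field_simps)
    have "(N 0 powr ((s + t) / 2 - 1))\<^sup>2 = N 0 powr (s - 1) * N 0 powr (t - 1)"
      "(N 1 powr (- ((s + t) / 2)))\<^sup>2 = N 1 powr (- s) * N 1 powr (- t)"
      using halves by (simp_all only: power2_eq_square flip: powr_add)
    then show ?thesis
      by (simp add: w_def power_mult_distrib)
  qed
  have \<phi>_mid: "(\<phi> ((s + t) / 2))\<^sup>2 \<le> \<phi> s * \<phi> t" if "s \<in> {0..1}" "t \<in> {0..1}" for s t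
  proof -
    have "(\<phi> ((s + t) / 2))\<^sup>2 = (N ((s + t) / 2))\<^sup>2 * (w s * w t)"
      by (simp add: \<phi>_def power_mult_distrib w_mid)
    also have "\<dots> \<le> (N s * N t) * (w s * w t)"
      using mid[OF that] w_pos[of s] w_pos[of t] by (intro mult_right_mono) auto
    finally show ?thesis
      by (simp add: \<phi>_def mult_ac)
  qed
  have ends: "\<phi> 0 = 1" "\<phi> 1 = 1"
    using pos by (simp_all add: \<phi>_def w_def powr_minus)
  have w_bound: "w t \<le> exp \<bar>ln (N 0)\<bar> * exp \<bar>ln (N 1)\<bar>" if "t \<in> {0..1}" for t
  proof -
    have "\<bar>(t - 1) * ln (N 0)\<bar> \<le> \<bar>ln (N 0)\<bar>" "\<bar>- t * ln (N 1)\<bar> \<le> \<bar>ln (N 1)\<bar>"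
      using that by (auto simp: abs_mult intro!: mult_left_le_one_le)
    then show ?thesis
      using pos unfolding w_def by (intro mult_mono) (auto simp: powr_def abs_le_iff)
  qed
  have "\<phi> t \<le> C * (exp \<bar>ln (N 0)\<bar> * exp \<bar>ln (N 1)\<bar>)" if "t \<in> {0..1}" for t
    unfolding \<phi>_def using bound[OF that] w_bound[OF that] w_pos[of t] nonneg[of t]
    by (intro mult_mono) auto
  then have bdd: "bdd_above (\<phi> ` {0..1})"
    by (intro bdd_aboveI2)
  define S where "S = (SUP t\<in>{0..1}. \<phi> t)"
  have le_S: "\<phi> t \<le> S" if "t \<in> {0..1}" for t
    unfolding S_def using bdd that by (rule cSUP_upper2[OF _ _ order_refl])
  have "S \<ge> 1"
    using le_S[of 0] ends by simp
  have "\<phi> t \<le> sqrt S" if "t \<in> {0..1}" for t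
  proof -
    have "(\<phi> t)\<^sup>2 \<le> S"
    proof (cases "t \<le> 1 / 2")
      case True
      then show ?thesis
        using \<phi>_mid[of 0 "2 * t"] le_S[of "2 * t"] that ends by simp
    next
      case False
      then show ?thesis
        using \<phi>_mid[of 1 "2 * t - 1"] le_S[of "2 * t - 1"] that ends by simp
    qed
    then show ?thesis
      by (rule real_le_rsqrt)
  qed
  then have "S \<le> sqrt S"
    unfolding S_def by (intro cSUP_least) auto
  then have "S * S \<le> S"
    using \<open>S \<ge> 1\<close> by (metis abs_le_square_iff abs_of_nonneg order_trans power2_eq_square
        real_sqrt_ge_zero real_sqrt_pow2 zero_le_one)
  then have "S \<le> 1"
    using \<open>S \<ge> 1\<close> by (simp add: mult_le_cancel_left2)
  then have "\<phi> t \<le> 1"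
    using le_S[OF t] by simp
  then have "N t * w t * (N 0 powr (1 - t) * N 1 powr t) \<le> 1 * (N 0 powr (1 - t) * N 1 powr t)"
    unfolding \<phi>_def by (intro mult_right_mono) auto
  moreover have "w t * (N 0 powr (1 - t) * N 1 powr t) = 1"
    using pos by (simp add: w_def powr_diff powr_minus field_simps)
  ultimately show ?thesis
    by (simp add: mult.assoc)
qed

lemma norm_pow_elt_log_convex:
  fixes g :: "'a::unital_cstar_algebra"
  assumes x: "x \<in> pos_inv" and y: "y \<in> pos_inv" and g: "invertible_elt g" and t: "t \<in> {0..1}"
  shows "norm (pow_elt x t * g * pow_elt y t) \<le> norm g powr (1 - t) * norm (x * g * y) powr t"
proof -
  have pos: "norm z > 0" if "invertible_elt z" for z :: 'a
    using inv_elt_mult(1)[OF that] by (cases "z = 0") auto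
  have "invertible_elt (x * g * y)"
    by (intro invertible_mult g pos_inv_invertible[OF x] pos_inv_invertible[OF y])
  have "norm (pow_elt x t * g * pow_elt y t) \<le> norm (pow_elt x 0 * g * pow_elt y 0) powr (1 - t)
      * norm (pow_elt x 1 * g * pow_elt y 1) powr t"
  proof (rule log_convex_if_midpoint_log_convex[where N = "\<lambda>t. norm (pow_elt x t * g * pow_elt y t)"
        and C = "(1 + norm x) * norm g * (1 + norm y)"])
    fix t :: real assume "t \<in> {0..1}"
    then show "norm (pow_elt x t * g * pow_elt y t) \<le> (1 + norm x) * norm g * (1 + norm y)"
      by (intro order_trans[OF norm_mult_ineq] mult_mono norm_pow_elt_le x y) auto
  qed (use t pos[OF g] pos[OF \<open>invertible_elt (x * g * y)\<close>] in
      \<open>auto simp: pow_elt_0 pow_elt_1 x y intro: norm_pow_elt_midpoint\<close>)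
  then show ?thesis
    by (simp add: pow_elt_0 pow_elt_1 x y)
qed

section \<open>Unitaries\<close>

lemma norm_unitary_mult:
  assumes "unitary u"
  shows "norm (u * a) = norm a"
proof -
  have "star (u * a) * (u * a) = star a * (star u * u) * a"
    by (simp add: star_mult mult.assoc)
  then have "(norm (u * a))\<^sup>2 = (norm a)\<^sup>2"
    using assms by (simp add: unitary_def flip: cstar_identity)
  then show ?thesis
    by simp
qed

lemma unitary_star: "unitary u \<Longrightarrow> unitary (star u)"
  by (simp add: unitary_def star_star)

lemma norm_mult_unitary:
  assumes "unitary u"
  shows "norm (a * u) = norm a"
  using norm_unitary_mult[OF unitary_star[OF assms], of "star a"] norm_star[of "a * u"]
  by (simp add: star_mult)

lemma norm_unitary: "unitary u \<Longrightarrow> norm u = 1"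
  using norm_unitary_mult[of u 1] by simp

lemma unitary_if_mult_star:
  fixes u :: "'a::unital_cstar_algebra"
  assumes "invertible_elt u" "u * star u = 1"
  shows "unitary u"
proof -
  have "star u = inv_elt u * (u * star u)"
    using assms(1) by (simp flip: mult.assoc)
  then show ?thesis
    using assms by (simp add: unitary_def)
qed

text \<open>
  For \<open>q = (zz\<^sup>*)\<^sup>1\<^sup>/\<^sup>2\<close> the element \<open>u = q\<^sup>-\<^sup>1 z\<close> satisfies \<open>uu\<^sup>* = q\<^sup>-\<^sup>1 q\<^sup>2 q\<^sup>-\<^sup>1 = 1\<close>.
\<close>

lemma polar_decomposition:
  fixes z :: "'a::unital_cstar_algebra"
  assumes z: "invertible_elt z"
  obtains u where "unitary u" "pow_elt (z * star z) (1/2) = z * star u"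
    "pow_elt (z * star z) (-1/2) = u * inv_elt z"
proof -
  let ?p = "z * star z"
  have p: "?p \<in> pos_inv"
    by (rule mult_star_pos_inv[OF z])
  define q where "q = pow_elt ?p (1/2)"
  define q' where "q' = pow_elt ?p (-1/2)"
  have qq': "q * q' = 1" "q' * q = 1"
    using pow_elt_inverse[OF p, of "1/2"] by (simp_all add: q_def q'_def)
  have sa: "star q' = q'" "star q = q"
    by (simp_all add: q'_def q_def star_pow_elt p)
  have "q * q = ?p"
    using pow_elt_half_mult_half[OF p, of 1] by (simp add: q_def pow_elt_1 p)
  define u where "u = q' * z"
  have "u * star u = q' * ?p * q'"
    by (simp add: u_def star_mult sa mult.assoc)
  also have "\<dots> = (q' * q) * (q * q')"
    by (simp only: \<open>q * q = ?p\<close>[symmetric] mult.assoc)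
  finally have "u * star u = 1"
    by (simp add: qq')
  moreover have "invertible_elt u"
    unfolding u_def q'_def by (intro invertible_mult inv_pow_elt p z)
  ultimately have "unitary u"
    by (intro unitary_if_mult_star)
  moreover have "q' = u * inv_elt z"
    using z by (simp add: u_def mult.assoc)
  moreover have "q * (u * star u) = z * star u"
    using qq' by (simp add: u_def flip: mult.assoc)
  then have "q = z * star u"
    by (simp add: \<open>u * star u = 1\<close>)
  ultimately show ?thesis
    using that by (simp add: q_def q'_def)
qed

lemma norm_half_powers:
  fixes z w :: "'a::unital_cstar_algebra"
  assumes "invertible_elt z" "invertible_elt w"
  shows "norm (pow_elt (z * star z) (-1/2) * h * pow_elt (w * star w) (1/2)) = norm (inv_elt z * h * w)"
proof -
  obtain u where u: "unitary u" "pow_elt (z * star z) (-1/2) = u * inv_elt z"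
    using polar_decomposition[OF assms(1)] by metis
  obtain v where v: "unitary v" "pow_elt (w * star w) (1/2) = w * star v"
    using polar_decomposition[OF assms(2)] by metis
  have "norm (u * ((inv_elt z * h * w) * star v)) = norm (inv_elt z * h * w)"
    by (simp add: norm_unitary_mult norm_mult_unitary unitary_star u v)
  then show ?thesis
    by (simp only: u(2) v(2) mult.assoc)
qed

lemma conjugate_pos_inv:
  fixes b :: "'a::unital_cstar_algebra"
  assumes b: "b \<in> pos_inv" and z: "invertible_elt z" "star z = z"
  shows "z * b * z \<in> pos_inv"
proof -
  let ?w = "z * pow_elt b (1/2)"
  have "?w * star ?w = z * (pow_elt b (1/2) * pow_elt b (1/2)) * z"
    by (simp add: star_mult star_pow_elt b z mult.assoc)
  also have "\<dots> = z * b * z"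
    by (simp only: pow_elt_half_mult_half[OF b] pow_elt_1[OF b])
  finally show ?thesis
    using mult_star_pos_inv[OF invertible_mult(1)[OF z(1) inv_pow_elt(1)[OF b]], of "1/2"] by simp
qed

section \<open>Geodesics\<close>

text \<open>
  Here \<open>x\<close> is the square root of \<open>y = a\<^sup>-\<^sup>1\<^sup>/\<^sup>2 b a\<^sup>-\<^sup>1\<^sup>/\<^sup>2\<close>, so that \<open>y\<^sup>t = x\<^sup>t x\<^sup>t\<close>. Up to a unitary, the
  factor \<open>z = a\<^sup>1\<^sup>/\<^sup>2 x\<^sup>t\<close> is the square root of the point of the geodesic, but unlike the square
  root it is a product of powers.
\<close>

lemma geodesic_factorization:
  fixes a b :: "'a::unital_cstar_algebra"
  assumes a: "a \<in> pos_inv" and b: "b \<in> pos_inv"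
  obtains x where "x \<in> pos_inv"
    "\<And>t. geodesic a b t = (pow_elt a (1/2) * pow_elt x t) * star (pow_elt a (1/2) * pow_elt x t)"
    "\<And>t. invertible_elt (pow_elt a (1/2) * pow_elt x t)"
    "\<And>t. inv_elt (pow_elt a (1/2) * pow_elt x t) = pow_elt x (- t) * pow_elt a (-1/2)"
proof -
  define y where "y = pow_elt a (-1/2) * b * pow_elt a (-1/2)"
  have y: "y \<in> pos_inv"
    unfolding y_def by (intro conjugate_pos_inv b inv_pow_elt star_pow_elt a)
  show ?thesis
  proof
    show x: "pow_elt y (1/2) \<in> pos_inv"
      by (rule pow_elt_pos_inv[OF y])
    fix t
    show "geodesic a b t = (pow_elt a (1/2) * pow_elt (pow_elt y (1/2)) t) *
        star (pow_elt a (1/2) * pow_elt (pow_elt y (1/2)) t)"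
    proof -
      have "pow_elt y t = pow_elt (pow_elt y (1/2)) t * pow_elt (pow_elt y (1/2)) t"
        by (simp add: pow_elt_pow_elt[OF y] flip: pow_elt_add[OF y])
      then show ?thesis
        unfolding geodesic_def y_def[symmetric]
        by (simp add: star_mult star_pow_elt a x mult.assoc)
    qed
    show "invertible_elt (pow_elt a (1/2) * pow_elt (pow_elt y (1/2)) t)"
      "inv_elt (pow_elt a (1/2) * pow_elt (pow_elt y (1/2)) t)
        = pow_elt (pow_elt y (1/2)) (- t) * pow_elt a (-1/2)"
      using invertible_mult[OF inv_pow_elt(1)[OF a] inv_pow_elt(1)[OF x], of "1/2" t]
      by (simp_all add: inv_pow_elt a x)
  qed
qed

lemma geodesic_pos_inv:
  assumes "a \<in> pos_inv" "b \<in> pos_inv"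
  shows "geodesic a b t \<in> pos_inv"
  by (rule geodesic_factorization[OF assms]) (metis mult_star_pos_inv)

lemma geodesic_0:
  assumes a: "a \<in> pos_inv" and b: "b \<in> pos_inv"
  shows "geodesic a b 0 = a"
proof -
  obtain x where x: "x \<in> pos_inv"
    "\<And>t. geodesic a b t = (pow_elt a (1/2) * pow_elt x t) * star (pow_elt a (1/2) * pow_elt x t)"
    using geodesic_factorization[OF a b] by metis
  have "geodesic a b 0 = pow_elt a (1/2) * pow_elt a (1/2)"
    by (simp add: x pow_elt_0 star_pow_elt a)
  then show ?thesis
    by (simp only: pow_elt_half_mult_half[OF a] pow_elt_1[OF a])
qed

lemma geodesic_1:
  assumes a: "a \<in> pos_inv" and b: "b \<in> pos_inv"
  shows "geodesic a b 1 = b"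
proof -
  have inv: "pow_elt a (1/2) * pow_elt a (-1/2) = 1" "pow_elt a (-1/2) * pow_elt a (1/2) = 1"
    using pow_elt_inverse[OF a, of "1/2"] by simp_all
  have "pow_elt a (-1/2) * b * pow_elt a (-1/2) \<in> pos_inv"
    by (intro conjugate_pos_inv b inv_pow_elt star_pow_elt a)
  then have "geodesic a b 1 = (pow_elt a (1/2) * pow_elt a (-1/2)) * b * (pow_elt a (-1/2) * pow_elt a (1/2))"
    unfolding geodesic_def by (simp add: pow_elt_1 mult.assoc)
  then show ?thesis
    by (simp only: inv mult_1_left mult_1_right)
qed

lemma geodesic_one_square:
  fixes s :: "'a::unital_cstar_algebra"
  assumes "s \<in> pos_inv"
  shows "geodesic 1 (s\<^sup>2) t = pow_elt s (2 * t)"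
  by (simp add: geodesic_def pow_elt_one pow_elt_square assms)

text \<open>
  With the factors \<open>z = a\<^sup>1\<^sup>/\<^sup>2 x\<^sup>t\<close> of the two geodesics in place of their square roots, the left-hand
  side becomes the norm of \<open>x\<^sup>-\<^sup>t g y\<^sup>t\<close> with \<open>g = a\<^sup>-\<^sup>1\<^sup>/\<^sup>2 h c\<^sup>1\<^sup>/\<^sup>2\<close>, which is log-convex in \<open>t\<close>.
\<close>

lemma norm_between_geodesics_log_convex:
  fixes a b c d h :: "'a::unital_cstar_algebra"
  assumes a: "a \<in> pos_inv" and b: "b \<in> pos_inv" and c: "c \<in> pos_inv" and d: "d \<in> pos_inv"
    and h: "invertible_elt h" and t: "t \<in> {0..1}"
  shows "norm (pow_elt (geodesic a b t) (-1/2) * h * pow_elt (geodesic c d t) (1/2))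
    \<le> norm (pow_elt a (-1/2) * h * pow_elt c (1/2)) powr (1 - t)
      * norm (pow_elt b (-1/2) * h * pow_elt d (1/2)) powr t"
proof -
  from geodesic_factorization[OF a b] obtain x where x: "x \<in> pos_inv"
    "\<And>t. geodesic a b t = (pow_elt a (1/2) * pow_elt x t) * star (pow_elt a (1/2) * pow_elt x t)"
    "\<And>t. invertible_elt (pow_elt a (1/2) * pow_elt x t)"
    "\<And>t. inv_elt (pow_elt a (1/2) * pow_elt x t) = pow_elt x (- t) * pow_elt a (-1/2)"
    by metis
  from geodesic_factorization[OF c d] obtain y where y: "y \<in> pos_inv"
    "\<And>t. geodesic c d t = (pow_elt c (1/2) * pow_elt y t) * star (pow_elt c (1/2) * pow_elt y t)"
    "\<And>t. invertible_elt (pow_elt c (1/2) * pow_elt y t)"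
    by metis
  define g where "g = pow_elt a (-1/2) * h * pow_elt c (1/2)"
  have N: "norm (pow_elt (geodesic a b t) (-1/2) * h * pow_elt (geodesic c d t) (1/2))
      = norm (pow_elt (pow_elt x (-1)) t * g * pow_elt y t)" for t
    unfolding x(2) y(2) norm_half_powers[OF x(3) y(3)] x(4)
    by (simp add: g_def pow_elt_pow_elt x(1) mult.assoc)
  have x': "pow_elt x (-1) \<in> pos_inv"
    by (rule pow_elt_pos_inv[OF x(1)])
  have "invertible_elt g"
    unfolding g_def by (intro invertible_mult h inv_pow_elt a c)
  then have "norm (pow_elt (pow_elt x (-1)) t * g * pow_elt y t)
      \<le> norm g powr (1 - t) * norm (pow_elt x (-1) * g * y) powr t"
    using norm_pow_elt_log_convex[OF x' y(1)] t by blast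
  moreover have "norm (pow_elt x (-1) * g * y)
      = norm (pow_elt b (-1/2) * h * pow_elt d (1/2))"
    using N[of 1] by (simp add: geodesic_1 a b c d pow_elt_1 x' y(1))
  ultimately show ?thesis
    unfolding N by (simp add: g_def)
qed

section \<open>Unitarizers and fixed points\<close>

lemma invertible_groupD: "invertible_group H \<Longrightarrow> h \<in> H \<Longrightarrow> invertible_elt h"
  by (simp add: invertible_group_def)

lemma conj_group_conj_group:
  assumes "invertible_elt s" "invertible_elt v"
  shows "conj_group v (conj_group s H) = conj_group (s * v) H"
  unfolding conj_group_def image_image by (simp add: invertible_mult assms mult.assoc)

lemma pow_conj_group_eq:
  "a \<in> pos_inv \<Longrightarrow> pow_conj_group a t H = conj_group (pow_elt a t) H"
  by (simp add: pow_conj_group_def conj_group_def inv_pow_elt)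

lemma unitarizer_conj_group:
  assumes s: "invertible_elt s" and v: "invertible_elt v"
  shows "unitarizer v (conj_group s H) \<longleftrightarrow> unitarizer (s * v) H"
  by (simp add: unitarizer_def conj_group_conj_group invertible_mult s v)

text \<open>For \<open>u = s\<^sup>-\<^sup>1hs\<close> the equation \<open>uu\<^sup>* = 1\<close> reads \<open>h(ss\<^sup>*)h\<^sup>* = ss\<^sup>*\<close>.\<close>

lemma unitarizer_iff_fixed:
  fixes s :: "'a::unital_cstar_algebra"
  assumes H: "invertible_group H" and s: "invertible_elt s"
  shows "unitarizer s H \<longleftrightarrow> s * star s \<in> pos_fixed H"
proof -
  have "unitary (inv_elt s * h * s) \<longleftrightarrow> h * (s * star s) * star h = s * star s" if "h \<in> H" for h
  proof -
    let ?u = "inv_elt s * h * s"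
    have inv: "invertible_elt ?u"
      by (intro invertible_mult invertible_inv_elt s invertible_groupD[OF H that])
    have "?u * star ?u = inv_elt s * (h * (s * star s) * star h) * star (inv_elt s)"
      by (simp add: star_mult mult.assoc)
    moreover have "inv_elt s * y * star (inv_elt s) = 1 \<longleftrightarrow> y = s * star s" for y
    proof
      assume "inv_elt s * y * star (inv_elt s) = 1"
      then have "s * (inv_elt s * y * star (inv_elt s)) * star s = s * star s"
        by simp
      moreover have "s * (inv_elt s * y * star (inv_elt s)) * star s
          = (s * inv_elt s) * y * (star (inv_elt s) * star s)"
        by (simp only: mult.assoc)
      ultimately show "y = s * star s"
        using s by (simp flip: star_mult)
    next
      assume "y = s * star s"
      then have "inv_elt s * y * star (inv_elt s) = (inv_elt s * s) * (star s * star (inv_elt s))"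
        by (simp only: mult.assoc)
      then show "inv_elt s * y * star (inv_elt s) = 1"
        using s by (simp flip: star_mult)
    qed
    ultimately have "?u * star ?u = 1 \<longleftrightarrow> h * (s * star s) * star h = s * star s"
      by simp
    then show ?thesis
      using unitary_if_mult_star[OF inv] by (auto simp: unitary_def)
  qed
  then show ?thesis
    using s mult_star_pos_inv[OF s] by (simp add: unitarizer_def conj_group_def pos_fixed_def)
qed

lemma unitarizer_pow_half:
  assumes H: "invertible_group H" and p: "p \<in> pos_fixed H"
  shows "unitarizer (pow_elt p (1/2)) H"
proof -
  have p': "p \<in> pos_inv"
    using p by (simp add: pos_fixed_def)
  have "pow_elt p (1/2) * star (pow_elt p (1/2)) = p"
    using pow_elt_half_mult_half[OF p', of 1] by (simp add: star_pow_elt p' pow_elt_1)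
  then show ?thesis
    using p unitarizer_iff_fixed[OF H inv_pow_elt(1)[OF p']] by simp
qed

text \<open>
  If \<open>h\<close> fixes \<open>a\<close> and \<open>b\<close>, then \<open>k = a\<^sup>-\<^sup>1\<^sup>/\<^sup>2 h a\<^sup>1\<^sup>/\<^sup>2\<close> is a unitary which commutes with
  \<open>x = a\<^sup>-\<^sup>1\<^sup>/\<^sup>2 b a\<^sup>-\<^sup>1\<^sup>/\<^sup>2\<close>, hence with \<open>x\<^sup>t\<close>.
\<close>

lemma geodesic_pos_fixed:
  fixes a b :: "'a::unital_cstar_algebra"
  assumes H: "invertible_group H" and fa: "a \<in> pos_fixed H" and fb: "b \<in> pos_fixed H"
  shows "geodesic a b t \<in> pos_fixed H"
proof -
  have a: "a \<in> pos_inv" and b: "b \<in> pos_inv"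
    using fa fb by (simp_all add: pos_fixed_def)
  define \<alpha> where "\<alpha> = pow_elt a (1/2)"
  define \<beta> where "\<beta> = pow_elt a (-1/2)"
  define x where "x = \<beta> * b * \<beta>"
  have ab: "\<alpha> * \<beta> = 1" "\<beta> * \<alpha> = 1"
    using pow_elt_inverse[OF a, of "1/2"] by (simp_all add: \<alpha>_def \<beta>_def)
  have sa: "star \<alpha> = \<alpha>" "star \<beta> = \<beta>"
    by (simp_all add: \<alpha>_def \<beta>_def star_pow_elt a)
  have aa: "\<alpha> * \<alpha> = a"
    using pow_elt_half_mult_half[OF a, of 1] by (simp add: \<alpha>_def pow_elt_1 a)
  have x: "x \<in> pos_inv"
    unfolding x_def \<beta>_def by (intro conjugate_pos_inv b inv_pow_elt star_pow_elt a)
  have "h * geodesic a b t * star h = geodesic a b t" if h: "h \<in> H" for h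
  proof -
    define k where "k = \<beta> * h * \<alpha>"
    have hk: "\<alpha> * k = h * \<alpha>" "star k * \<alpha> = \<alpha> * star h"
      using ab by (simp_all add: k_def star_mult sa mult.assoc flip: mult.assoc[of \<alpha> \<beta>])
    have "k * star k = \<beta> * (h * (\<alpha> * \<alpha>) * star h) * \<beta>"
      by (simp add: k_def star_mult sa mult.assoc)
    also have "h * (\<alpha> * \<alpha>) * star h = \<alpha> * \<alpha>"
      using fa h by (simp add: aa pos_fixed_def)
    also have "\<beta> * (\<alpha> * \<alpha>) * \<beta> = (\<beta> * \<alpha>) * (\<alpha> * \<beta>)"
      by (simp only: mult.assoc)
    finally have "k * star k = 1"
      by (simp add: ab)
    moreover have "invertible_elt k"
      unfolding k_def \<alpha>_def \<beta>_def
      by (intro invertible_mult invertible_groupD[OF H h] inv_pow_elt a)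
    ultimately have "unitary k"
      by (intro unitary_if_mult_star)
    have "k * x * star k = \<beta> * h * (\<alpha> * \<beta>) * b * (\<beta> * \<alpha>) * star h * \<beta>"
      by (simp add: k_def x_def star_mult sa mult.assoc)
    also have "\<dots> = \<beta> * (h * b * star h) * \<beta>"
      by (simp add: ab mult.assoc)
    also have "h * b * star h = b"
      using fb h by (simp add: pos_fixed_def)
    finally have "k * x * star k * k = x * k"
      by (simp add: x_def)
    then have kx: "k * x = x * k"
      using \<open>unitary k\<close> by (simp add: unitary_def mult.assoc)
    have "h * geodesic a b t * star h = (h * \<alpha>) * pow_elt x t * (\<alpha> * star h)"
      by (simp add: geodesic_def x_def \<alpha>_def \<beta>_def mult.assoc)
    also have "\<dots> = \<alpha> * (k * pow_elt x t) * star k * \<alpha>"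
      by (simp only: hk[symmetric] mult.assoc)
    also have "k * pow_elt x t = pow_elt x t * k"
      by (rule pow_elt_commute[OF x kx])
    also have "\<alpha> * (pow_elt x t * k) * star k * \<alpha> = \<alpha> * pow_elt x t * (k * star k) * \<alpha>"
      by (simp only: mult.assoc)
    also have "\<dots> = geodesic a b t"
      by (simp add: \<open>k * star k = 1\<close> geodesic_def x_def \<alpha>_def \<beta>_def)
    finally show ?thesis .
  qed
  then show ?thesis
    using geodesic_pos_inv[OF a b] by (simp add: pos_fixed_def)
qed

section \<open>Group size and similarity number\<close>

definition condition_number :: "'a::unital_cstar_algebra \<Rightarrow> real" where
  "condition_number s = norm s * norm (inv_elt s)"

lemma condition_number_ge_1:
  "invertible_elt s \<Longrightarrow> 1 \<le> condition_number s"
  unfolding condition_number_def using norm_mult_ineq[of s "inv_elt s"] by simp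

lemma condition_number_mult_le:
  assumes "invertible_elt a" "invertible_elt b"
  shows "condition_number (a * b) \<le> condition_number a * condition_number b"
proof -
  have "condition_number (a * b) \<le> (norm a * norm b) * (norm (inv_elt b) * norm (inv_elt a))"
    unfolding condition_number_def by (simp add: invertible_mult assms mult_mono norm_mult_ineq)
  then show ?thesis
    by (simp add: condition_number_def mult_ac)
qed

lemma sim_eq: "sim H = Inf (condition_number ` {s. unitarizer s H})"
  by (simp add: sim_def condition_number_def setcompr_eq_image)

lemma sim_le:
  assumes "unitarizer s H"
  shows "sim H \<le> condition_number s"
  unfolding sim_eq
proof (rule cInf_lower)
  show "bdd_below (condition_number ` {s. unitarizer s H})"
    by (rule bdd_belowI2[of _ 1]) (auto simp: unitarizer_def intro: condition_number_ge_1)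
qed (use assms in auto)

lemma sim_greatest:
  assumes "unitarizable H" "\<And>s. unitarizer s H \<Longrightarrow> c \<le> condition_number s"
  shows "c \<le> sim H"
  unfolding sim_eq using assms by (intro cInf_greatest) (auto simp: unitarizable_def)

lemma unitarizable_conj_group:
  assumes H: "unitarizable H" and s: "invertible_elt s"
  shows "unitarizable (conj_group s H)"
proof -
  obtain u where u: "unitarizer u H"
    using H by (auto simp: unitarizable_def)
  have u': "invertible_elt (inv_elt s * u)"
    using u s by (simp add: unitarizer_def invertible_mult invertible_inv_elt)
  have "s * (inv_elt s * u) = u"
    using s by (simp flip: mult.assoc)
  then have "unitarizer (inv_elt s * u) (conj_group s H)"
    using u unitarizer_conj_group[OF s u'] by simp
  then show ?thesis
    by (auto simp: unitarizable_def)
qed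

lemma group_size_geodesic_log_convex:
  fixes H :: "'a::unital_cstar_algebra set"
  assumes H: "invertible_group H" "uniformly_bounded H"
    and a: "a \<in> pos_inv" and b: "b \<in> pos_inv" and t: "t \<in> {0..1}"
  shows "group_size (pow_conj_group (geodesic a b t) (1/2) H)
    \<le> group_size (pow_conj_group a (1/2) H) powr (1 - t)
      * group_size (pow_conj_group b (1/2) H) powr t"
proof -
  have le: "norm (pow_elt p (-1/2) * h * pow_elt p (1/2)) \<le> group_size (pow_conj_group p (1/2) H)"
    if "h \<in> H" for p h
  proof -
    obtain C where C: "\<And>h. h \<in> H \<Longrightarrow> norm h \<le> C"
      using H(2) by (auto simp: uniformly_bounded_def bdd_above_def)
    have "bdd_above (norm ` pow_conj_group p (1/2) H)"
    proof (rule bdd_aboveI2)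
      fix g assume "g \<in> pow_conj_group p (1/2) H"
      then obtain h where "h \<in> H" "g = pow_elt p (- (1/2)) * h * pow_elt p (1/2)"
        by (auto simp: pow_conj_group_def)
      then show "norm g \<le> norm (pow_elt p (- (1/2))) * C * norm (pow_elt p (1/2))"
        using C[OF \<open>h \<in> H\<close>] order_trans[OF norm_ge_zero C[OF \<open>h \<in> H\<close>]]
        by (auto intro!: order_trans[OF norm_mult_ineq] mult_mono mult_nonneg_nonneg)
    qed
    then show ?thesis
      unfolding group_size_def using that by (intro cSUP_upper) (auto simp: pow_conj_group_def)
  qed
  show ?thesis
    unfolding group_size_def[of "pow_conj_group (geodesic a b t) (1/2) H"]
  proof (rule cSUP_least)
    show "pow_conj_group (geodesic a b t) (1/2) H \<noteq> {}"
      using H(1) by (auto simp: pow_conj_group_def invertible_group_def)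
    fix g assume "g \<in> pow_conj_group (geodesic a b t) (1/2) H"
    then obtain h where h: "h \<in> H"
      and g: "g = pow_elt (geodesic a b t) (-1/2) * h * pow_elt (geodesic a b t) (1/2)"
      by (auto simp: pow_conj_group_def)
    have "norm g \<le> norm (pow_elt a (-1/2) * h * pow_elt a (1/2)) powr (1 - t)
        * norm (pow_elt b (-1/2) * h * pow_elt b (1/2)) powr t"
      unfolding g by (rule norm_between_geodesics_log_convex[OF a b a b invertible_groupD[OF H(1) h] t])
    also have "\<dots> \<le> group_size (pow_conj_group a (1/2) H) powr (1 - t)
        * group_size (pow_conj_group b (1/2) H) powr t"
      using t le[OF h] by (intro mult_mono powr_mono2) auto
    finally show "norm g \<le> group_size (pow_conj_group a (1/2) H) powr (1 - t)
        * group_size (pow_conj_group b (1/2) H) powr t" .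
  qed
qed

lemma le_Inf_powr_mult:
  fixes A B :: "real set"
  assumes ne: "A \<noteq> {}" "B \<noteq> {}" and pos: "\<And>x. x \<in> A \<Longrightarrow> 1 \<le> x" "\<And>x. x \<in> B \<Longrightarrow> 1 \<le> x"
    and t: "t \<in> {0..1}"
    and le: "\<And>x y. \<lbrakk>x \<in> A; y \<in> B\<rbrakk> \<Longrightarrow> v \<le> x powr (1 - t) * y powr t"
  shows "v \<le> Inf A powr (1 - t) * Inf B powr t"
proof (rule tendsto_lowerbound)
  have one: "1 \<le> Inf A" "1 \<le> Inf B"
    using ne pos by (auto intro!: cInf_greatest)
  have e: "(\<lambda>n. inverse (real (Suc n))) \<longlonglongrightarrow> 0"
    by (rule LIMSEQ_inverse_real_of_nat)
  have lim: "(\<lambda>n. (c + inverse (real (Suc n))) powr r) \<longlonglongrightarrow> c powr r" if "1 \<le> c" for c r :: real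
    using tendsto_powr[OF tendsto_add[OF tendsto_const e] tendsto_const, of c r] that by simp
  show "(\<lambda>n. (Inf A + inverse (real (Suc n))) powr (1 - t) * (Inf B + inverse (real (Suc n))) powr t)
      \<longlonglongrightarrow> Inf A powr (1 - t) * Inf B powr t"
    by (intro tendsto_mult lim one)
  show "\<forall>\<^sub>F n in sequentially. v \<le> (Inf A + inverse (real (Suc n))) powr (1 - t)
      * (Inf B + inverse (real (Suc n))) powr t"
  proof (rule always_eventually, rule allI)
    fix n
    obtain x where x: "x \<in> A" "x < Inf A + inverse (real (Suc n))"
      using cInf_lessD[OF ne(1), of "Inf A + inverse (real (Suc n))"] by auto
    obtain y where y: "y \<in> B" "y < Inf B + inverse (real (Suc n))"
      using cInf_lessD[OF ne(2), of "Inf B + inverse (real (Suc n))"] by auto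
    have "x powr (1 - t) * y powr t \<le> (Inf A + inverse (real (Suc n))) powr (1 - t)
        * (Inf B + inverse (real (Suc n))) powr t"
      using x y pos(1)[OF x(1)] pos(2)[OF y(1)] t by (intro mult_mono powr_mono2) auto
    then show "v \<le> (Inf A + inverse (real (Suc n))) powr (1 - t)
        * (Inf B + inverse (real (Suc n))) powr t"
      using le[OF x(1) y(1)] by simp
  qed
qed simp

text \<open>
  Unitarizers \<open>u\<close> and \<open>v\<close> of the end groups correspond to the fixed points \<open>a\<^sup>1\<^sup>/\<^sup>2uu\<^sup>*a\<^sup>1\<^sup>/\<^sup>2\<close> and
  \<open>b\<^sup>1\<^sup>/\<^sup>2vv\<^sup>*b\<^sup>1\<^sup>/\<^sup>2\<close> of \<open>H\<close>. The geodesic \<open>p\<^sub>t\<close> between these consists of fixed points, and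
  \<open>\<gamma>\<^sub>t\<^sup>-\<^sup>1\<^sup>/\<^sup>2 p\<^sub>t\<^sup>1\<^sup>/\<^sup>2\<close> is a unitarizer of the group at time \<open>t\<close>. The norms of it and of its inverse
  are log-convex.
\<close>

lemma sim_geodesic_log_convex:
  fixes H :: "'a::unital_cstar_algebra set"
  assumes H: "invertible_group H" and un: "unitarizable H"
    and a: "a \<in> pos_inv" and b: "b \<in> pos_inv" and t: "t \<in> {0..1}"
  shows "sim (pow_conj_group (geodesic a b t) (1/2) H)
    \<le> sim (pow_conj_group a (1/2) H) powr (1 - t) * sim (pow_conj_group b (1/2) H) powr t"
proof -
  define \<gamma> where "\<gamma> = geodesic a b t"
  have \<gamma>: "\<gamma> \<in> pos_inv"
    unfolding \<gamma>_def by (rule geodesic_pos_inv[OF a b])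
  have inv: "inv_elt (pow_elt p (1/2)) = pow_elt p (-1/2)" if "p \<in> pos_inv" for p :: 'a
    using inv_pow_elt(2)[OF that, of "1/2"] by simp
  have "sim (pow_conj_group \<gamma> (1/2) H) \<le> condition_number u powr (1 - t) * condition_number v powr t"
    if u: "unitarizer u (pow_conj_group a (1/2) H)" and v: "unitarizer v (pow_conj_group b (1/2) H)" for u v
  proof -
    have fixed: "\<exists>p. p \<in> pos_fixed H \<and> norm (pow_elt e (-1/2) * 1 * pow_elt p (1/2)) = norm w
        \<and> norm (pow_elt p (-1/2) * 1 * pow_elt e (1/2)) = norm (inv_elt w)"
      if e: "e \<in> pos_inv" and w: "unitarizer w (pow_conj_group e (1/2) H)" for e w
    proof -
      define \<epsilon> where "\<epsilon> = pow_elt e (1/2)"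
      have \<epsilon>: "invertible_elt \<epsilon>" "star \<epsilon> = \<epsilon>" "\<epsilon> * \<epsilon> = e"
        using pow_elt_half_mult_half[OF e, of 1]
        by (simp_all add: \<epsilon>_def inv_pow_elt star_pow_elt e pow_elt_1)
      then have ee: "\<epsilon> * star \<epsilon> = e"
        by simp
      have w': "invertible_elt w"
        using w by (simp add: unitarizer_def)
      have ew: "invertible_elt (\<epsilon> * w)" "inv_elt (\<epsilon> * w) = inv_elt w * inv_elt \<epsilon>"
        by (simp_all add: invertible_mult \<epsilon> w')
      let ?p = "(\<epsilon> * w) * star (\<epsilon> * w)"
      have "unitarizer (\<epsilon> * w) H"
        using w unitarizer_conj_group[OF \<epsilon>(1) w'] by (simp add: pow_conj_group_eq e \<epsilon>_def)
      then have "?p \<in> pos_fixed H"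
        using unitarizer_iff_fixed[OF H ew(1)] by simp
      moreover have "norm (pow_elt e (-1/2) * 1 * pow_elt ?p (1/2)) = norm w"
        using norm_half_powers[OF \<epsilon>(1) ew(1), of 1] \<epsilon>(1) by (simp add: ee flip: mult.assoc)
      moreover have "norm (pow_elt ?p (-1/2) * 1 * pow_elt e (1/2)) = norm (inv_elt w)"
        using norm_half_powers[OF ew(1) \<epsilon>(1), of 1] \<epsilon>(1) by (simp add: ee ew(2) mult.assoc)
      ultimately show ?thesis
        by blast
    qed
    obtain p where p: "p \<in> pos_fixed H" "norm (pow_elt a (-1/2) * 1 * pow_elt p (1/2)) = norm u"
      "norm (pow_elt p (-1/2) * 1 * pow_elt a (1/2)) = norm (inv_elt u)"
      using fixed[OF a u] by blast
    obtain q where q: "q \<in> pos_fixed H" "norm (pow_elt b (-1/2) * 1 * pow_elt q (1/2)) = norm v"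
      "norm (pow_elt q (-1/2) * 1 * pow_elt b (1/2)) = norm (inv_elt v)"
      using fixed[OF b v] by blast
    have pq: "p \<in> pos_inv" "q \<in> pos_inv"
      using p(1) q(1) by (simp_all add: pos_fixed_def)
    define r where "r = geodesic p q t"
    have "r \<in> pos_fixed H"
      unfolding r_def by (rule geodesic_pos_fixed[OF H p(1) q(1)])
    then have r: "r \<in> pos_inv" "unitarizer (pow_elt r (1/2)) H"
      using unitarizer_pow_half[OF H] by (simp_all add: pos_fixed_def)
    define w where "w = pow_elt \<gamma> (-1/2) * pow_elt r (1/2)"
    have w: "invertible_elt w" "inv_elt w = pow_elt r (-1/2) * pow_elt \<gamma> (1/2)"
      using inv_pow_elt(2)[OF \<gamma>, of "-1/2"]
      by (simp_all add: w_def invertible_mult inv_pow_elt(1) \<gamma> r inv)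
    have "pow_elt \<gamma> (1/2) * w = pow_elt r (1/2)"
      using pow_elt_inverse(1)[OF \<gamma>, of "1/2"] by (simp add: w_def flip: mult.assoc)
    then have "unitarizer w (pow_conj_group \<gamma> (1/2) H)"
      using r unitarizer_conj_group[OF inv_pow_elt(1)[OF \<gamma>] w(1)] by (simp add: pow_conj_group_eq \<gamma>)
    then have "sim (pow_conj_group \<gamma> (1/2) H) \<le> condition_number w"
      by (rule sim_le)
    also have "\<dots> = norm (pow_elt \<gamma> (-1/2) * 1 * pow_elt r (1/2))
        * norm (pow_elt r (-1/2) * 1 * pow_elt \<gamma> (1/2))"
      by (simp add: condition_number_def w) (simp add: w_def)
    also have "\<dots> \<le> (norm u powr (1 - t) * norm v powr t)
        * (norm (inv_elt u) powr (1 - t) * norm (inv_elt v) powr t)"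
    proof -
      have one: "invertible_elt (1::'a)"
        by (rule pos_inv_invertible[OF one_pos_inv])
      show ?thesis
        using norm_between_geodesics_log_convex[OF a b pq one t]
          norm_between_geodesics_log_convex[OF pq a b one t]
        unfolding p(2,3) q(2,3) \<gamma>_def r_def by (intro mult_mono) auto
    qed
    also have "\<dots> = condition_number u powr (1 - t) * condition_number v powr t"
      by (simp add: condition_number_def powr_mult)
    finally show ?thesis .
  qed
  moreover have "condition_number ` {s. unitarizer s (pow_conj_group e (1/2) H)} \<noteq> {}" if "e \<in> pos_inv" for e
    using unitarizable_conj_group[OF un inv_pow_elt(1)[OF that]]
    by (auto simp: unitarizable_def pow_conj_group_eq that)
  ultimately show ?thesis
    unfolding \<gamma>_def[symmetric] sim_eq[of "pow_conj_group a (1/2) H"] sim_eq[of "pow_conj_group b (1/2) H"]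
    using a b by (intro le_Inf_powr_mult t) (auto simp: unitarizer_def intro: condition_number_ge_1)
qed


section \<open>The distance to the fixed points\<close>

lemma real_spectrum_log_elt:
  assumes "p \<in> pos_inv"
  shows "real_spectrum (log_elt p) = ln ` real_spectrum p"
  unfolding log_elt_def
  using assms by (intro real_spectrum_cfc pos_inv_selfadjoint continuous_intros) (auto simp: pos_inv_iff)

lemma norm_pow_elt_le_exp:
  fixes p :: "'a::unital_cstar_algebra"
  assumes p: "p \<in> pos_inv"
  shows "norm (pow_elt p t) \<le> exp (\<bar>t\<bar> * norm (log_elt p))"
proof -
  obtain y where y: "y \<in> real_spectrum (pow_elt p t)" "\<bar>y\<bar> = norm (pow_elt p t)"
    using norm_in_real_spectrum[OF star_pow_elt[OF p]] by metis
  then obtain x where x: "x \<in> real_spectrum p" "y = x powr t"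
    by (auto simp: real_spectrum_pow_elt p)
  have "x > 0"
    using x(1) p by (auto simp: pos_inv_iff)
  have "\<bar>ln x\<bar> \<le> norm (log_elt p)"
    using x(1) by (intro abs_le_norm_if_in_real_spectrum) (simp add: real_spectrum_log_elt p)
  then have "\<bar>t * ln x\<bar> \<le> \<bar>t\<bar> * norm (log_elt p)"
    by (simp add: abs_mult mult_left_mono)
  then have "exp (t * ln x) \<le> exp (\<bar>t\<bar> * norm (log_elt p))"
    unfolding exp_le_cancel_iff by (rule abs_le_D1)
  moreover have "norm (pow_elt p t) = exp (t * ln x)"
    using y(2) x(2) \<open>x > 0\<close> by (simp add: powr_def)
  ultimately show ?thesis
    by (simp only:)
qed

lemma norm_log_elt_le:
  fixes p :: "'a::unital_cstar_algebra"
  assumes p: "p \<in> pos_inv" and "norm p \<le> exp D" "norm (pow_elt p (-1)) \<le> exp D"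
  shows "norm (log_elt p) \<le> D"
  unfolding log_elt_def
proof (rule norm_cfc_le)
  fix x assume x: "x \<in> real_spectrum p"
  then have "x > 0"
    using p by (auto simp: pos_inv_iff)
  have "x \<le> exp D"
    using abs_le_norm_if_in_real_spectrum[OF x] assms(2) by simp
  moreover have "x powr (-1) \<in> real_spectrum (pow_elt p (-1))"
    using x by (simp add: real_spectrum_pow_elt p)
  then have "inverse x \<le> exp D"
    using abs_le_norm_if_in_real_spectrum[of "x powr (-1)"] assms(3) \<open>x > 0\<close>
    by (fastforce simp: powr_minus)
  ultimately have "ln x \<le> ln (exp D)" "ln (inverse x) \<le> ln (exp D)"
    using \<open>x > 0\<close> by (simp_all only: ln_le_cancel_iff exp_gt_zero positive_imp_inverse_positive)
  then show "\<bar>ln x\<bar> \<le> D"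
    using \<open>x > 0\<close> by (simp add: ln_inverse abs_le_iff)
qed (use p in \<open>auto intro!: pos_inv_selfadjoint continuous_intros simp: pos_inv_iff\<close>)

lemma pdist_one: "pdist 1 b = norm (log_elt b)"
  by (simp add: pdist_def pow_elt_one)

lemma inv_elt_scaleR:
  fixes a :: "'a::real_algebra_1"
  assumes "invertible_elt a" "c \<noteq> 0"
  shows "invertible_elt (c *\<^sub>R a)" "inv_elt (c *\<^sub>R a) = inverse c *\<^sub>R inv_elt a"
  using inv_eltI[of "c *\<^sub>R a" "inverse c *\<^sub>R inv_elt a"] assms by simp_all

text \<open>
  The set of fixed points is closed under positive scalars. For a unitarizer \<open>u\<close> the multiple \<open>v\<close>
  with \<open>norm v = norm v\<^sup>-\<^sup>1\<close> gives a fixed point \<open>vv\<^sup>*\<close> at distance at most \<open>ln (condition_number u)\<close>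
  from \<open>1\<close>.
\<close>

lemma exp_pdist_set_le_sim:
  fixes H :: "'a::unital_cstar_algebra set"
  assumes H: "invertible_group H" and un: "unitarizable H"
  shows "exp (pdist_set 1 (pos_fixed H)) \<le> sim H"
proof (rule sim_greatest[OF un])
  fix u assume u: "unitarizer u H"
  then have inv: "invertible_elt u"
    by (simp add: unitarizer_def)
  have cond: "condition_number u > 0"
    using condition_number_ge_1[OF inv] by simp
  then have pos: "norm u > 0" "norm (inv_elt u) > 0"
    by (auto simp: condition_number_def zero_less_mult_iff)
  define c where "c = sqrt (norm (inv_elt u) / norm u)"
  have c: "c > 0" "c\<^sup>2 = norm (inv_elt u) / norm u"
    using pos by (simp_all add: c_def)
  define v where "v = c *\<^sub>R u"
  have v: "invertible_elt v" "inv_elt v = inverse c *\<^sub>R inv_elt u"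
    unfolding v_def using c by (simp_all add: inv_elt_scaleR inv)
  have "(norm v)\<^sup>2 = c\<^sup>2 * (norm u)\<^sup>2" "(norm (inv_elt v))\<^sup>2 = inverse (c\<^sup>2) * (norm (inv_elt u))\<^sup>2"
    by (simp_all add: v(2) power_mult_distrib power_inverse) (simp add: v_def power_mult_distrib)
  then have nv: "(norm v)\<^sup>2 = condition_number u" "(norm (inv_elt v))\<^sup>2 = condition_number u"
    unfolding c(2) using pos by (simp_all add: condition_number_def power2_eq_square)
  have "inv_elt v * h * v = inv_elt u * h * u" for h
    unfolding v(2) unfolding v_def using c by simp
  then have "conj_group v H = conj_group u H"
    by (simp add: conj_group_def)
  then have "unitarizer v H"
    using u v(1) by (simp add: unitarizer_def)
  define p where "p = v * star v"
  have fixed: "p \<in> pos_fixed H"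
    using unitarizer_iff_fixed[OF H v(1)] \<open>unitarizer v H\<close> by (simp add: p_def)
  have p: "p \<in> pos_inv"
    unfolding p_def by (rule mult_star_pos_inv[OF v(1)])
  have "pow_elt p (-1) = inv_elt p"
    using inv_pow_elt(2)[OF p, of 1] by (simp add: pow_elt_1 p)
  also have "\<dots> = star (inv_elt v) * inv_elt v"
    by (simp add: p_def invertible_mult star_inverse v(1))
  finally have "norm (pow_elt p (-1)) = condition_number u"
    by (simp add: cstar_identity nv)
  moreover have "norm p = condition_number u"
    by (simp add: p_def cstar_identity' nv)
  ultimately have "norm (log_elt p) \<le> ln (condition_number u)"
    using cond by (intro norm_log_elt_le p) simp_all
  moreover have "pdist_set 1 (pos_fixed H) \<le> pdist 1 p"
    unfolding pdist_set_def using fixed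
    by (intro cINF_lower bdd_belowI2[of _ 0]) (auto simp: pdist_one)
  ultimately have "pdist_set 1 (pos_fixed H) \<le> ln (condition_number u)"
    by (simp add: pdist_one)
  then show "exp (pdist_set 1 (pos_fixed H)) \<le> condition_number u"
    using cond by (simp add: ln_ge_iff)
qed

lemma condition_number_pow_elt_le:
  fixes s :: "'a::unital_cstar_algebra"
  assumes s: "s \<in> pos_inv" and t: "t \<ge> 0"
  shows "condition_number (pow_elt s t) \<le> exp (t * pdist 1 (s\<^sup>2))"
proof -
  have pow: "pow_elt s r = pow_elt (s\<^sup>2) (r / 2)" for r
    by (simp add: pow_elt_square(2) s)
  have "norm (pow_elt s r) \<le> exp (\<bar>r / 2\<bar> * norm (log_elt (s\<^sup>2)))" for r
    unfolding pow by (rule norm_pow_elt_le_exp[OF pow_elt_square(1)[OF s]])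
  from this[of t] this[of "- t"] have "norm (pow_elt s t) * norm (pow_elt s (- t)) \<le>
      exp (\<bar>t / 2\<bar> * norm (log_elt (s\<^sup>2))) * exp (\<bar>- t / 2\<bar> * norm (log_elt (s\<^sup>2)))"
    by (intro mult_mono) simp_all
  also have "\<dots> = exp (t * pdist 1 (s\<^sup>2))"
    using t by (simp add: pdist_one flip: exp_add)
  finally show ?thesis
    by (simp add: condition_number_def inv_pow_elt s)
qed

text \<open>
  Composing an arbitrary unitarizer of \<open>s\<^sup>-\<^sup>tHs\<^sup>t\<close> with \<open>s\<^sup>t\<close> gives a unitarizer of \<open>H\<close>. Minimality
  of \<open>s\<close> bounds the condition number of \<open>s\<^sup>t\<close> by \<open>sim H powr t\<close>.
\<close>

lemma sim_powr_le_sim_pow_conj_group: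
  fixes H :: "'a::unital_cstar_algebra set"
  assumes H: "invertible_group H" and s: "s \<in> pos_inv" and un: "unitarizer s H"
    and min: "pdist_set 1 (pos_fixed H) = pdist 1 (s\<^sup>2)" and t: "t \<ge> 0"
  shows "sim H powr (1 - t) \<le> sim (pow_conj_group s t H)"
proof (rule sim_greatest)
  have uH: "unitarizable H"
    using un by (auto simp: unitarizable_def)
  then have le_sim: "exp (pdist 1 (s\<^sup>2)) \<le> sim H"
    using exp_pdist_set_le_sim[OF H] min by simp
  then have pos: "sim H > 0"
    using exp_gt_zero less_le_trans by blast
  show "unitarizable (pow_conj_group s t H)"
    using unitarizable_conj_group[OF uH inv_pow_elt(1)[OF s]] by (simp add: pow_conj_group_eq s)
  fix u assume u: "unitarizer u (pow_conj_group s t H)"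
  then have inv: "invertible_elt u"
    by (simp add: unitarizer_def)
  have "unitarizer (pow_elt s t * u) H"
    using u unitarizer_conj_group[OF inv_pow_elt(1)[OF s] inv] by (simp add: pow_conj_group_eq s)
  then have "sim H \<le> condition_number (pow_elt s t * u)"
    by (rule sim_le)
  also have "\<dots> \<le> condition_number (pow_elt s t) * condition_number u"
    by (rule condition_number_mult_le[OF inv_pow_elt(1)[OF s] inv])
  also have "\<dots> \<le> sim H powr t * condition_number u"
  proof (rule mult_right_mono)
    have "condition_number (pow_elt s t) \<le> exp (pdist 1 (s\<^sup>2)) powr t"
      using condition_number_pow_elt_le[OF s t] by (simp add: powr_def mult.commute)
    also have "\<dots> \<le> sim H powr t"
      using le_sim t by (intro powr_mono2) auto
    finally show "condition_number (pow_elt s t) \<le> sim H powr t" .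
    show "0 \<le> condition_number u"
      using condition_number_ge_1[OF inv] by simp
  qed
  finally show "sim H powr (1 - t) \<le> condition_number u"
    using pos by (simp add: powr_diff field_simps)
qed

lemma group_size_unitary:
  assumes "unitarizer s H" "H \<noteq> {}"
  shows "group_size (conj_group s H) = 1"
proof -
  have "norm u = 1" if "u \<in> conj_group s H" for u
    using assms that by (intro norm_unitary) (auto simp: unitarizer_def)
  then have "norm ` conj_group s H = {1}"
    using assms(2) by (auto simp: conj_group_def image_iff)
  then show ?thesis
    by (simp add: group_size_def)
qed

lemma sim_unitary_le:
  fixes s :: "'a::unital_cstar_algebra"
  assumes "unitarizer s H"
  shows "sim (conj_group s H) \<le> 1"
proof -
  have one: "invertible_elt (1::'a)" "inv_elt (1::'a) = 1"
    using inv_eltI[of "1::'a" 1] by simp_all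
  have "unitarizer 1 (conj_group s H)"
    using assms unitarizer_conj_group[OF _ one(1)] by (simp add: unitarizer_def)
  from sim_le[OF this] show ?thesis
    by (simp add: condition_number_def one)
qed

lemma sim_nonneg:
  assumes "unitarizable H"
  shows "0 \<le> sim H"
  by (rule sim_greatest[OF assms]) (simp add: condition_number_def)

lemma pow_conj_group_square:
  fixes s :: "'a::unital_cstar_algebra"
  assumes "s \<in> pos_inv"
  shows "pow_conj_group (s\<^sup>2) (1/2) H = conj_group s H"
  by (simp add: pow_conj_group_eq pow_elt_square assms pow_elt_1)

lemma pow_conj_group_one:
  fixes H :: "'a::unital_cstar_algebra set"
  shows "pow_conj_group 1 t H = H"
  by (simp add: pow_conj_group_def pow_elt_one)

theorem theorem4p5:
  fixes H :: "'a::unital_cstar_algebra set" and r s :: 'a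
    and \<gamma> :: "real \<Rightarrow> 'a" and Ht :: "real \<Rightarrow> 'a set"
  assumes "invertible_group H" and "uniformly_bounded H"
    and "r \<in> pos_inv" and "s \<in> pos_inv"
    and "\<And>t. \<gamma> t = geodesic (r\<^sup>2) (s\<^sup>2) t"
    and "\<And>t. Ht t = pow_conj_group (\<gamma> t) (1/2) H"
  shows "(Ht 0 = conj_group r H \<and> Ht 1 = conj_group s H) \<and>
    (\<forall>t\<in>{0..1}. group_size (Ht t)
        \<le> group_size (conj_group r H) powr (1 - t) * group_size (conj_group s H) powr t) \<and>
    (unitarizable H \<longrightarrow>
      (\<forall>t\<in>{0..1}. sim (Ht t)
        \<le> sim (conj_group r H) powr (1 - t) * sim (conj_group s H) powr t)) \<and>
    (unitarizer s H \<and> pdist_set 1 (pos_fixed H) = pdist 1 (s\<^sup>2) \<longrightarrow>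
      (\<forall>t\<in>{0..1}. group_size (pow_conj_group s t H) \<le> group_size H powr (1 - t) \<and>
        sim (pow_conj_group s t H) = sim H powr (1 - t)))"
proof (intro conjI impI ballI)
  note H = assms(1,2) and r = assms(3) and s = assms(4)
  have squares: "r\<^sup>2 \<in> pos_inv" "s\<^sup>2 \<in> pos_inv"
    by (simp_all add: pow_elt_square r s)
  show "Ht 0 = conj_group r H" "Ht 1 = conj_group s H"
    by (simp_all add: assms(5,6) geodesic_0 geodesic_1 squares pow_conj_group_square r s)
  show "group_size (Ht t) \<le> group_size (conj_group r H) powr (1 - t) * group_size (conj_group s H) powr t"
    if "t \<in> {0..1}" for t
    using group_size_geodesic_log_convex[OF H squares that]
    by (simp add: assms(5,6) pow_conj_group_square r s)
  show "sim (Ht t) \<le> sim (conj_group r H) powr (1 - t) * sim (conj_group s H) powr t"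
    if "unitarizable H" "t \<in> {0..1}" for t
    using sim_geodesic_log_convex[OF H(1) that(1) squares that(2)]
    by (simp add: assms(5,6) pow_conj_group_square r s)
  assume "unitarizer s H \<and> pdist_set 1 (pos_fixed H) = pdist 1 (s\<^sup>2)"
  then have un: "unitarizer s H" and min: "pdist_set 1 (pos_fixed H) = pdist 1 (s\<^sup>2)"
    by simp_all
  have uH: "unitarizable H"
    using un by (auto simp: unitarizable_def)
  fix t :: real assume t: "t \<in> {0..1}"
  have eq: "pow_conj_group (geodesic 1 (s\<^sup>2) t) (1/2) H = pow_conj_group s t H"
    by (simp add: geodesic_one_square s pow_conj_group_eq pow_elt_pos_inv pow_elt_pow_elt)
  have "H \<noteq> {}"
    using H(1) by (auto simp: invertible_group_def)
  then show "group_size (pow_conj_group s t H) \<le> group_size H powr (1 - t)"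
    using group_size_geodesic_log_convex[OF H one_pos_inv squares(2) t]
    by (simp add: eq pow_conj_group_one pow_conj_group_square s group_size_unitary[OF un])
  have "sim (pow_conj_group s t H) \<le> sim H powr (1 - t) * sim (conj_group s H) powr t"
    using sim_geodesic_log_convex[OF H(1) uH one_pos_inv squares(2) t]
    by (simp add: eq pow_conj_group_one pow_conj_group_square s)
  also have "\<dots> \<le> sim H powr (1 - t) * 1"
  proof (rule mult_left_mono)
    show "sim (conj_group s H) powr t \<le> 1"
      using sim_unitary_le[OF un] sim_nonneg[OF unitarizable_conj_group[OF uH pos_inv_invertible[OF s]]] t
      by (intro powr_le1) auto
  qed simp
  finally have "sim (pow_conj_group s t H) \<le> sim H powr (1 - t)"
    by simp
  moreover have "sim H powr (1 - t) \<le> sim (pow_conj_group s t H)"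
    using sim_powr_le_sim_pow_conj_group[OF H(1) s un min] t by simp
  ultimately show "sim (pow_conj_group s t H) = sim H powr (1 - t)"
    by (rule antisym)
qed

end
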